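(* If $n\geq 2$ and $k>2^{n-1}$, there is a computable coloring $f:[\mathbb{N}]^n\rightarrow\{1,\dots,k\}$ and a computable $\phi:\mathbb{N}\rightarrow\mathbb{N}$ with $w\rightarrow(\phi(w))^n_{k+1}$ for all $w$ and $\liminf_w\phi(w)=\infty$, such that no $\Sigma^0_n$ definable set is both packed for $\phi$ and semi-homogeneous for $f$.
   Context: $[X]^n$ is the set of $n$-element subsets of $X$. $w\rightarrow(m)^n_k$ means: for every $X\subseteq\mathbb{N}$ with $|X|=w$ and every $g:[X]^n\rightarrow\{1,\dots,k\}$ there is $H\subseteq X$ with $|H|=m$ on whose $n$-element subsets $g$ is constant. $A$ is packed for $\phi$ if $|A\cap\{1,\dots,w\}|\geq\phi(w)$ for infinitely many $w$. $A$ is semi-homogeneous for $f$ if $f$ takes at most $2^{n-1}$ values on $[A]^n$. *)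

theory Defs
  imports "HOL-Library.Ramsey" "HOL-Library.Extended_Nat" "HOL-Library.Liminf_Limsup"
begin

section \<open>Computable functions\<close>

text \<open>
  Terms for the partial recursive functions. Terms carry no arity: a term denotes a partial function
  on argument lists of every length, and restricted to lists of a fixed length it denotes a partial
  recursive function of that arity.
\<close>

datatype recf =
    Zero
  | Succ
  | Proj nat
  | Comp recf "recf list"
  | PrimRec recf recf
  | Mu recf

inductive evaluates :: "recf \<Rightarrow> nat list \<Rightarrow> nat \<Rightarrow> bool" where
  evaluates_Zero: "evaluates Zero xs 0"
| evaluates_Succ: "evaluates Succ [x] (Suc x)"
| evaluates_Proj: "i < length xs \<Longrightarrow> evaluates (Proj i) xs (xs ! i)"
| evaluates_Comp:
    "list_all2 (\<lambda>g y. evaluates g xs y) gs ys \<Longrightarrow> evaluates f ys z \<Longrightarrow> evaluates (Comp f gs) xs z"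
| evaluates_PrimRec_0: "evaluates f xs y \<Longrightarrow> evaluates (PrimRec f g) (0 # xs) y"
| evaluates_PrimRec_Suc:
    "evaluates (PrimRec f g) (m # xs) r \<Longrightarrow> evaluates g (m # r # xs) y \<Longrightarrow>
     evaluates (PrimRec f g) (Suc m # xs) y"
| evaluates_Mu:
    "evaluates f (m # xs) 0 \<Longrightarrow> (\<forall>i<m. \<exists>y. evaluates f (i # xs) (Suc y)) \<Longrightarrow>
     evaluates (Mu f) xs m"

inductive_cases evaluates_ZeroE: "evaluates Zero xs z"
inductive_cases evaluates_SuccE: "evaluates Succ xs z"
inductive_cases evaluates_ProjE: "evaluates (Proj i) xs z"
inductive_cases evaluates_CompE: "evaluates (Comp f gs) xs z"
inductive_cases evaluates_PrimRec_0E: "evaluates (PrimRec f g) (0 # xs) z"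
inductive_cases evaluates_PrimRec_SucE: "evaluates (PrimRec f g) (Suc m # xs) z"
inductive_cases evaluates_MuE: "evaluates (Mu f) xs z"

lemma evaluates_deterministic: "evaluates e xs y \<Longrightarrow> evaluates e xs z \<Longrightarrow> y = z"
proof (induction arbitrary: z rule: evaluates.induct)
  case (evaluates_Zero xs)
  then show ?case by (rule evaluates_ZeroE) simp
next
  case (evaluates_Succ x)
  then show ?case by (rule evaluates_SuccE) simp
next
  case (evaluates_Proj i xs)
  from evaluates_Proj(2) show ?case by (rule evaluates_ProjE) simp
next
  case (evaluates_Comp xs gs ys f y)
  obtain ys' where
    ys': "list_all2 (\<lambda>g y. evaluates g xs y) gs ys'" "evaluates f ys' z"
    using evaluates_Comp.prems by (rule evaluates_CompE)
  have "ys = ys'"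
  proof (rule nth_equalityI)
    show "length ys = length ys'"
      using list_all2_lengthD[OF evaluates_Comp.IH(1)] list_all2_lengthD[OF ys'(1)] by simp
    fix i assume "i < length ys"
    then have i: "i < length gs" using list_all2_lengthD[OF evaluates_Comp.IH(1)] by simp
    from list_all2_nthD[OF evaluates_Comp.IH(1) i] list_all2_nthD[OF ys'(1) i]
    show "ys ! i = ys' ! i" by blast
  qed
  with ys'(2) show ?case by (intro evaluates_Comp.IH(2)) simp
next
  case (evaluates_PrimRec_0 f xs y g)
  from evaluates_PrimRec_0.prems have "evaluates f xs z" by (rule evaluates_PrimRec_0E)
  then show ?case by (rule evaluates_PrimRec_0.IH)
next
  case (evaluates_PrimRec_Suc f g m xs r y)
  obtain r' where r': "evaluates (PrimRec f g) (m # xs) r'" "evaluates g (m # r' # xs) z"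
    using evaluates_PrimRec_Suc.prems by (rule evaluates_PrimRec_SucE)
  from r'(1) have "r = r'" by (rule evaluates_PrimRec_Suc.IH(1))
  with r'(2) show ?case by (intro evaluates_PrimRec_Suc.IH(2)) simp
next
  case (evaluates_Mu f m xs)
  have z: "evaluates f (z # xs) 0" "\<forall>i<z. \<exists>y. evaluates f (i # xs) (Suc y)"
    by (rule evaluates_MuE[OF evaluates_Mu.prems]; assumption)+
  show ?case
  proof (rule linorder_cases[of m z])
    assume "m < z"
    with z(2) obtain y where "evaluates f (m # xs) (Suc y)" by blast
    then have "0 = Suc y" by (rule evaluates_Mu.IH(1))
    then show ?thesis by simp
  next
    assume "z < m"
    with evaluates_Mu.IH(2) obtain y where "\<forall>v. evaluates f (z # xs) v \<longrightarrow> Suc y = v" by blast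
    with z(1) show ?thesis by blast
  qed
qed

definition computable :: "nat \<Rightarrow> (nat list \<Rightarrow> nat) \<Rightarrow> bool" where
  "computable n f \<longleftrightarrow> (\<exists>e. \<forall>xs. length xs = n \<longrightarrow> evaluates e xs (f xs))"

definition computable_fun :: "(nat \<Rightarrow> nat) \<Rightarrow> bool" where
  "computable_fun f \<longleftrightarrow> computable 1 (\<lambda>xs. f (hd xs))"

definition computable_rel :: "nat \<Rightarrow> (nat list \<Rightarrow> bool) \<Rightarrow> bool" where
  "computable_rel n R \<longleftrightarrow> computable n (\<lambda>xs. if R xs then 1 else 0)"

text \<open>
  A finite set of numbers is presented to an algorithm as its increasing enumeration. Since the
  set of increasing tuples is decidable, asking for a total computable extension to all
  tuples is no restriction.
\<close>

definition computable_coloring :: "nat \<Rightarrow> (nat set \<Rightarrow> nat) \<Rightarrow> bool" where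
  "computable_coloring n f \<longleftrightarrow>
     (\<exists>g. computable n g \<and> (\<forall>S\<in>[UNIV]\<^bsup>n\<^esup>. f S = g (sorted_list_of_set S)))"

section \<open>The arithmetical hierarchy\<close>

text \<open>
  \<open>ex_prefix n R xs\<close> is \<open>\<exists>y\<^sub>1. \<forall>y\<^sub>2. \<exists>y\<^sub>3. \<dots> R (xs @ [y\<^sub>1, \<dots>, y\<^sub>n])\<close>
  with \<open>n\<close> alternating quantifiers; \<open>all_prefix\<close> is the same starting with a universal one.
\<close>

fun ex_prefix :: "nat \<Rightarrow> (nat list \<Rightarrow> bool) \<Rightarrow> nat list \<Rightarrow> bool"
  and all_prefix :: "nat \<Rightarrow> (nat list \<Rightarrow> bool) \<Rightarrow> nat list \<Rightarrow> bool" where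
  "ex_prefix 0 R xs \<longleftrightarrow> R xs"
| "ex_prefix (Suc n) R xs \<longleftrightarrow> (\<exists>y. all_prefix n R (xs @ [y]))"
| "all_prefix 0 R xs \<longleftrightarrow> R xs"
| "all_prefix (Suc n) R xs \<longleftrightarrow> (\<forall>y. ex_prefix n R (xs @ [y]))"

definition sigma0 :: "nat \<Rightarrow> nat set \<Rightarrow> bool" where
  "sigma0 n A \<longleftrightarrow> (\<exists>R. computable_rel (Suc n) R \<and> A = {x. ex_prefix n R [x]})"

section \<open>Partition relations, packed and semi-homogeneous sets\<close>

text \<open>\<open>arrows w m n k\<close> is \<open>w \<rightarrow> (m)\<^sup>n\<^sub>k\<close>.\<close>

definition arrows :: "nat \<Rightarrow> nat \<Rightarrow> nat \<Rightarrow> nat \<Rightarrow> bool" where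
  "arrows w m n k \<longleftrightarrow>
     (\<forall>X\<in>[UNIV :: nat set]\<^bsup>w\<^esup>. \<forall>g \<in> [X]\<^bsup>n\<^esup> \<rightarrow> {1..k}.
        \<exists>H\<in>[X]\<^bsup>m\<^esup>. \<exists>c. \<forall>S\<in>[H]\<^bsup>n\<^esup>. g S = c)"

definition packed :: "(nat \<Rightarrow> nat) \<Rightarrow> nat set \<Rightarrow> bool" where
  "packed \<phi> A \<longleftrightarrow> (\<exists>\<^sub>\<infinity>w. card (A \<inter> {1..w}) \<ge> \<phi> w)"

text \<open>Finiteness of the image is required because \<open>card\<close> is \<open>0\<close> on infinite sets.\<close>

definition semi_homogeneous :: "nat \<Rightarrow> (nat set \<Rightarrow> nat) \<Rightarrow> nat set \<Rightarrow> bool" where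
  "semi_homogeneous n f A \<longleftrightarrow> finite (f ` [A]\<^bsup>n\<^esup>) \<and> card (f ` [A]\<^bsup>n\<^esup>) \<le> 2 ^ (n - 1)"

end

theory Submission
  imports Defs "HOL-Library.Nat_Bijection"
begin

text \<open>
  The colouring attains all \<open>k\<close> colours on every infinite \<open>\<Sigma>\<^sup>0\<^sub>n\<close> set, and a packed set is infinite as
  soon as \<open>\<phi>\<close> tends to infinity; so \<open>\<phi>\<close> can be any slow function read off a computable bound for
  Ramsey's theorem.

  For \<open>n = 2\<close>, membership in a \<open>\<Sigma>\<^sup>0\<^sub>2\<close> set has the form \<open>\<exists>y. \<forall>z. P x y z\<close>. At stage \<open>s\<close> each requirement
  (a \<open>\<Sigma>\<^sup>0\<^sub>2\<close> index \<open>e\<close> and a colour \<open>c\<close>) picks the least guess \<open>(x, y)\<close> not yet refuted by some \<open>z < s\<close>,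
  avoiding the numbers picked by the finitely many requirements before it, and the pair \<open>{x, s}\<close> gets
  colour \<open>c\<close>. For an infinite set with index \<open>e\<close> and late \<open>s\<close> the number picked belongs to the set, and \<open>s\<close>
  can be chosen in the set as well. For larger \<open>n\<close> the same colouring of pairs is an \<open>(n - 2)\<close>-fold
  iterated limit of a computable function; the stages of the limits serve as the further elements
  of the tuple.
\<close>

section \<open>Closure properties of computable functions\<close>

lemma computable_cong:
  assumes "computable n f" "\<And>xs. length xs = n \<Longrightarrow> f xs = g xs"
  shows "computable n g"
  using assms unfolding computable_def by metis

lemma computable_nth [intro]: "i < n \<Longrightarrow> computable n (\<lambda>xs. xs ! i)"
  unfolding computable_def by (intro exI[of _ "Proj i"]) (auto intro: evaluates_Proj)

lemma computable_Comp:
  assumes f: "computable (length gs) f" and gs: "\<And>g. g \<in> set gs \<Longrightarrow> computable n g"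
  shows "computable n (\<lambda>xs. f (map (\<lambda>g. g xs) gs))"
proof -
  obtain e where e: "\<And>xs. length xs = length gs \<Longrightarrow> evaluates e xs (f xs)"
    using f unfolding computable_def by blast
  obtain E where E: "\<And>g xs. g \<in> set gs \<Longrightarrow> length xs = n \<Longrightarrow> evaluates (E g) xs (g xs)"
    using gs unfolding computable_def by metis
  have "evaluates (Comp e (map E gs)) xs (f (map (\<lambda>g. g xs) gs))" if "length xs = n" for xs
    by (rule evaluates_Comp[where ys = "map (\<lambda>g. g xs) gs"])
      (auto simp: list_all2_conv_all_nth that intro!: e E)
  then show ?thesis unfolding computable_def by blast
qed

lemma computable_unary:
  assumes "computable 1 (\<lambda>ys. h (ys ! 0))" "computable n f"
  shows "computable n (\<lambda>xs. h (f xs))"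
  using computable_Comp[of "[f]" "\<lambda>ys. h (ys ! 0)" n] assms by simp

lemma computable_Suc: "computable n f \<Longrightarrow> computable n (\<lambda>xs. Suc (f xs))"
proof (rule computable_unary[where h = Suc])
  have "evaluates Succ xs (Suc (xs ! 0))" if "length xs = 1" for xs
    using that by (cases xs) (auto intro: evaluates_Succ)
  then show "computable 1 (\<lambda>ys. Suc (ys ! 0))" unfolding computable_def by blast
qed

lemma computable_const: "computable n (\<lambda>xs. c)"
proof (induction c)
  case 0
  show ?case unfolding computable_def using evaluates_Zero by blast
next
  case (Suc c)
  then show ?case by (rule computable_Suc)
qed

lemma computable_rec_nat:
  assumes b: "computable n b" and a: "computable n a" and g: "computable (Suc (Suc n)) g"
  shows "computable n (\<lambda>xs. rec_nat (a xs) (\<lambda>i r. g (i # r # xs)) (b xs))"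
proof -
  obtain ea where ea: "\<And>xs. length xs = n \<Longrightarrow> evaluates ea xs (a xs)"
    using a unfolding computable_def by blast
  obtain eg where eg: "\<And>xs. length xs = Suc (Suc n) \<Longrightarrow> evaluates eg xs (g xs)"
    using g unfolding computable_def by blast
  have rec: "evaluates (PrimRec ea eg) (m # xs) (rec_nat (a xs) (\<lambda>i r. g (i # r # xs)) m)"
    if "length xs = n" for m xs
    by (induction m) (auto intro!: evaluates_PrimRec_0 evaluates_PrimRec_Suc ea eg that)
  then have rec_n: "computable (Suc n)
      (\<lambda>ys. rec_nat (a (tl ys)) (\<lambda>i r. g (i # r # tl ys)) (hd ys))"
    unfolding computable_def
    by (intro exI[of _ "PrimRec ea eg"]) (auto simp: length_Suc_conv)
  \<comment> \<open>\<open>PrimRec\<close> recurses on the head of its argument list, so the depth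
    \<open>b xs\<close> is placed in front of the unchanged arguments, which the projections
    supply.\<close>
  let ?ps = "b # map (\<lambda>i xs. xs ! i) [0..<n]"
  show ?thesis
  proof (rule computable_cong)
    show "computable n (\<lambda>xs. (\<lambda>ys. rec_nat (a (tl ys)) (\<lambda>i r. g (i # r # tl ys)) (hd ys))
      (map (\<lambda>g. g xs) ?ps))"
      using b rec_n by (intro computable_Comp) auto
    fix xs :: "nat list"
    assume "length xs = n"
    then have "map (\<lambda>g. g xs) (map (\<lambda>i xs. xs ! i) [0..<n]) = xs"
      by (intro nth_equalityI) auto
    then show "(\<lambda>ys. rec_nat (a (tl ys)) (\<lambda>i r. g (i # r # tl ys)) (hd ys)) (map (\<lambda>g. g xs) ?ps)
        = rec_nat (a xs) (\<lambda>i r. g (i # r # xs)) (b xs)"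
      by simp
  qed
qed

lemma computable_add:
  assumes "computable n f" "computable n g"
  shows "computable n (\<lambda>xs. f xs + g xs)"
proof (rule computable_cong)
  show "computable n (\<lambda>xs. rec_nat (f xs) (\<lambda>i r. (\<lambda>ys. Suc (ys ! 1)) (i # r # xs)) (g xs))"
    using assms by (intro computable_rec_nat computable_Suc) auto
  have "rec_nat a (\<lambda>i r. Suc r) b = a + b" for a b
    by (induction b) auto
  then show "rec_nat (f xs) (\<lambda>i r. (\<lambda>ys. Suc (ys ! 1)) (i # r # xs)) (g xs) = f xs + g xs" for xs
    by simp
qed

lemma computable_diff:
  assumes "computable n f" "computable n g"
  shows "computable n (\<lambda>xs. f xs - g xs)"
proof (rule computable_cong)
  have pred: "computable n (\<lambda>xs. h xs - 1)" if "computable n h" for n h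
  proof (rule computable_cong)
    show "computable n (\<lambda>xs. rec_nat 0 (\<lambda>i r. (\<lambda>ys. ys ! 0) (i # r # xs)) (h xs))"
      using that by (intro computable_rec_nat computable_const) auto
    have "rec_nat 0 (\<lambda>i r. i) b = b - 1" for b
      by (cases b) auto
    then show "rec_nat 0 (\<lambda>i r. (\<lambda>ys. ys ! 0) (i # r # xs)) (h xs) = h xs - 1" for xs
      by simp
  qed
  show "computable n (\<lambda>xs. rec_nat (f xs) (\<lambda>i r. (\<lambda>ys. ys ! 1 - 1) (i # r # xs)) (g xs))"
    using assms by (intro computable_rec_nat pred) auto
  have "rec_nat a (\<lambda>i r. r - 1) b = a - b" for a b :: nat
    by (induction b) auto
  then show "rec_nat (f xs) (\<lambda>i r. (\<lambda>ys. ys ! 1 - 1) (i # r # xs)) (g xs) = f xs - g xs" for xs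
    by simp
qed

section \<open>The pairing function and its inverse\<close>

lemma computable_triangle:
  assumes "computable n f"
  shows "computable n (\<lambda>xs. triangle (f xs))"
proof (rule computable_cong)
  show "computable n
      (\<lambda>xs. rec_nat 0 (\<lambda>i r. (\<lambda>ys. ys ! 1 + Suc (ys ! 0)) (i # r # xs)) (f xs))"
    using assms by (intro computable_rec_nat computable_Suc computable_add computable_const) auto
  have "rec_nat 0 (\<lambda>i r. r + Suc i) b = triangle b" for b
    by (induction b) auto
  then show "rec_nat 0 (\<lambda>i r. (\<lambda>ys. ys ! 1 + Suc (ys ! 0)) (i # r # xs)) (f xs)
      = triangle (f xs)" for xs
    by simp
qed

lemma computable_prod_encode:
  assumes "computable n f" "computable n g"
  shows "computable n (\<lambda>xs. prod_encode (f xs, g xs))"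
  unfolding prod_encode_def case_prod_conv
  using assms by (intro computable_add computable_triangle)

text \<open>Subtraction is truncated, so the summand \<open>1 - (...)\<close> is 1 exactly when the
  next triangular number has been reached and 0 otherwise.\<close>

definition triangle_root :: "nat \<Rightarrow> nat" where
  "triangle_root = rec_nat 0 (\<lambda>i r. r + (1 - (triangle (Suc r) - Suc i)))"

lemma triangle_root: "triangle (triangle_root n) \<le> n \<and> n < triangle (Suc (triangle_root n))"
proof (induction n)
  case 0
  show ?case by (simp add: triangle_root_def)
next
  case (Suc n)
  have "triangle_root (Suc n) = (if triangle (Suc (triangle_root n)) \<le> Suc n
      then Suc (triangle_root n) else triangle_root n)"
    by (auto simp: triangle_root_def simp del: triangle_Suc)
  with Suc show ?case
    by auto
qed

lemma computable_triangle_root: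
  assumes "computable n f"
  shows "computable n (\<lambda>xs. triangle_root (f xs))"
proof (rule computable_cong)
  show "computable n (\<lambda>xs. rec_nat 0
      (\<lambda>i r. (\<lambda>ys. ys ! 1 + (1 - (triangle (Suc (ys ! 1)) - Suc (ys ! 0)))) (i # r # xs)) (f xs))"
    using assms
    by (intro computable_rec_nat computable_Suc computable_add computable_const computable_diff
        computable_triangle) auto
qed (simp add: triangle_root_def)

text \<open>Since \<open>prod_encode (a, b) = triangle (a + b) + a\<close>, the root recovers
  \<open>a + b\<close> and the remainder recovers \<open>a\<close>.\<close>

lemma prod_decode_triangle_root:
  "prod_decode n = (n - triangle (triangle_root n), triangle_root n - (n - triangle (triangle_root n)))"
proof -
  have "prod_encode (n - triangle (triangle_root n), triangle_root n - (n - triangle (triangle_root n))) = n"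
    using triangle_root[of n] by (simp add: prod_encode_def)
  then show ?thesis by (metis prod_encode_inverse)
qed

definition pfst :: "nat \<Rightarrow> nat" where "pfst n = fst (prod_decode n)"
definition psnd :: "nat \<Rightarrow> nat" where "psnd n = snd (prod_decode n)"

lemma pfst_prod_encode [simp]: "pfst (prod_encode p) = fst p"
  and psnd_prod_encode [simp]: "psnd (prod_encode p) = snd p"
  by (simp_all add: pfst_def psnd_def)

lemma prod_encode_pfst_psnd [simp]: "prod_encode (pfst n, psnd n) = n"
  by (simp add: pfst_def psnd_def)

lemma pfst_le: "pfst n \<le> n"
  using le_prod_encode_1[of "pfst n" "psnd n"] by simp

lemma computable_pfst: "computable n f \<Longrightarrow> computable n (\<lambda>xs. pfst (f xs))"
  and computable_psnd: "computable n f \<Longrightarrow> computable n (\<lambda>xs. psnd (f xs))"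
  unfolding pfst_def psnd_def prod_decode_triangle_root fst_conv snd_conv
  by (intro computable_diff computable_triangle computable_triangle_root; assumption)+

section \<open>Iterated limits of computable functions\<close>

lemma computable_fun_iff: "computable_fun f \<longleftrightarrow> computable 1 (\<lambda>xs. f (xs ! 0))"
  unfolding computable_fun_def
  by (auto elim!: computable_cong simp: length_Suc_conv)

lemma computable_app:
  "computable_fun f \<Longrightarrow> computable n g \<Longrightarrow> computable n (\<lambda>xs. f (g xs))"
  unfolding computable_fun_iff by (rule computable_unary)

text \<open>Primitive recursion for unary functions: \<open>p\<close> codes a parameter and a depth.
  Iterated limits are defined for unary functions only, and this is the form in which recursion
  passes through them.\<close>

definition nat_rec_coded :: "(nat \<Rightarrow> nat) \<Rightarrow> (nat \<Rightarrow> nat) \<Rightarrow> nat \<Rightarrow> nat" where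
  "nat_rec_coded f g p =
     rec_nat (f (pfst p)) (\<lambda>i r. g (prod_encode (pfst p, prod_encode (i, r)))) (psnd p)"

lemma computable_fun_comp: "computable_fun f \<Longrightarrow> computable_fun g \<Longrightarrow> computable_fun (\<lambda>x. f (g x))"
  unfolding computable_fun_iff by (rule computable_unary)

lemma computable_fun_pair:
  "computable_fun f \<Longrightarrow> computable_fun g \<Longrightarrow> computable_fun (\<lambda>x. prod_encode (f x, g x))"
  unfolding computable_fun_iff by (rule computable_prod_encode)

lemma computable_fun_basic:
  "computable_fun (\<lambda>x. x)" "computable_fun (\<lambda>x. c)" "computable_fun Suc" "computable_fun pfst"
  "computable_fun psnd" "computable_fun (\<lambda>x. x - 1)"
  unfolding computable_fun_iff
  by (rule computable_nth computable_const computable_Suc computable_pfst computable_psnd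
      computable_diff | simp)+

lemma computable_fun_rec:
  assumes "computable_fun f" "computable_fun g"
  shows "computable_fun (nat_rec_coded f g)"
  unfolding computable_fun_iff
proof (rule computable_cong)
  show "computable 1 (\<lambda>xs. rec_nat (f (pfst (xs ! 0))) (\<lambda>i r.
      (\<lambda>ys. g (prod_encode (pfst (ys ! 2), prod_encode (ys ! 0, ys ! 1)))) (i # r # xs)) (psnd (xs ! 0)))"
    using assms
    by (intro computable_rec_nat computable_psnd computable_pfst computable_app[of f]
        computable_app[of g] computable_prod_encode) auto
qed (simp add: nat_rec_coded_def)

text \<open>
  By the limit lemma these are the functions computable from the \<open>m\<close>-th jump; working with limits
  avoids oracle computations.
\<close>

primrec limit_computable :: "nat \<Rightarrow> (nat \<Rightarrow> nat) \<Rightarrow> bool" where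
  "limit_computable 0 f \<longleftrightarrow> computable_fun f"
| "limit_computable (Suc m) f \<longleftrightarrow>
     (\<exists>g. limit_computable m g \<and> (\<forall>x. eventually (\<lambda>s. g (prod_encode (x, s)) = f x) sequentially))"

lemma limit_computable_SucI:
  assumes "limit_computable m g" "\<And>x. eventually (\<lambda>s. g (prod_encode (x, s)) = f x) sequentially"
  shows "limit_computable (Suc m) f"
  using assms unfolding limit_computable.simps by blast

lemma limit_computable_SucE:
  assumes "limit_computable (Suc m) f"
  obtains g where "limit_computable m g"
    "\<And>x. eventually (\<lambda>s. g (prod_encode (x, s)) = f x) sequentially"
  using assms unfolding limit_computable.simps by blast

lemma limit_computable_computable: "computable_fun h \<Longrightarrow> limit_computable m h"
proof (induction m arbitrary: h)
  case (Suc m)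
  then have "computable_fun (\<lambda>x. h (pfst x))"
    by (intro computable_fun_comp[of h pfst] computable_fun_basic)
  then have "limit_computable m (\<lambda>x. h (pfst x))" by (rule Suc.IH)
  then show ?case by (rule limit_computable_SucI) simp
qed simp

text \<open>Both functions are run at the same stage \<open>s\<close>. Once the inner one has
  settled on \<open>g x\<close>, the outer one has a fixed argument and settles as well. Carrying
  \<open>s\<close> along takes pairing, hence the simultaneous induction.\<close>

lemma limit_computable_comp:
  "limit_computable m f \<Longrightarrow> limit_computable m g \<Longrightarrow> limit_computable m (\<lambda>x. f (g x))"
  and limit_computable_pair:
  "limit_computable m f \<Longrightarrow> limit_computable m g \<Longrightarrow> limit_computable m (\<lambda>x. prod_encode (f x, g x))"
proof (induction m arbitrary: f g and f g)
  case 0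
  { case 1 then show ?case by (simp add: computable_fun_comp) }
  { case 2 then show ?case by (simp add: computable_fun_pair) }
next
  case (Suc m)
  { case 1
    obtain f' where f': "limit_computable m f'"
      "\<And>x. eventually (\<lambda>s. f' (prod_encode (x, s)) = f x) sequentially"
      using limit_computable_SucE[OF 1(1)] by blast
    obtain g' where g': "limit_computable m g'"
      "\<And>x. eventually (\<lambda>s. g' (prod_encode (x, s)) = g x) sequentially"
      using limit_computable_SucE[OF 1(2)] by blast
    have "limit_computable m psnd" by (intro limit_computable_computable computable_fun_basic)
    then have "limit_computable m (\<lambda>p. f' (prod_encode (g' p, psnd p)))"
      using f'(1) g'(1) by (intro Suc.IH(1)[of f' "\<lambda>p. prod_encode (g' p, psnd p)"] Suc.IH(2))
    moreover have "eventually (\<lambda>s. f' (prod_encode (g' (prod_encode (x, s)),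
        psnd (prod_encode (x, s)))) = f (g x)) sequentially" for x
      using f'(2)[of "g x"] g'(2)[of x] by eventually_elim simp
    ultimately show ?case by (rule limit_computable_SucI) }
  { case 2
    obtain f' where f': "limit_computable m f'"
      "\<And>x. eventually (\<lambda>s. f' (prod_encode (x, s)) = f x) sequentially"
      using limit_computable_SucE[OF 2(1)] by blast
    obtain g' where g': "limit_computable m g'"
      "\<And>x. eventually (\<lambda>s. g' (prod_encode (x, s)) = g x) sequentially"
      using limit_computable_SucE[OF 2(2)] by blast
    have "limit_computable m (\<lambda>p. prod_encode (f' p, g' p))"
      using f'(1) g'(1) by (rule Suc.IH(2))
    moreover have "eventually (\<lambda>s. prod_encode (f' (prod_encode (x, s)), g' (prod_encode (x, s)))
        = prod_encode (f x, g x)) sequentially" for x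
      using f'(2)[of x] g'(2)[of x] by eventually_elim simp
    ultimately show ?case by (rule limit_computable_SucI) }
qed

lemma limit_computable_pfst: "limit_computable m f \<Longrightarrow> limit_computable m (\<lambda>x. pfst (f x))"
  and limit_computable_psnd: "limit_computable m f \<Longrightarrow> limit_computable m (\<lambda>x. psnd (f x))"
  and limit_computable_id: "limit_computable m (\<lambda>x. x)"
  by (auto intro: limit_computable_comp[OF limit_computable_computable[OF computable_fun_basic(4)]]
      limit_computable_comp[OF limit_computable_computable[OF computable_fun_basic(5)]]
      limit_computable_computable[OF computable_fun_basic(1)])

text \<open>For a fixed parameter and depth the recursion consults finitely many values of
  \<open>f\<close> and \<open>g\<close>; at late stages all of them have settled.\<close>

lemma limit_computable_rec:
  "limit_computable m f \<Longrightarrow> limit_computable m g \<Longrightarrow> limit_computable m (nat_rec_coded f g)"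
proof (induction m arbitrary: f g)
  case 0
  then show ?case by (simp add: computable_fun_rec)
next
  case (Suc m)
  obtain f' where f': "limit_computable m f'"
    "\<And>x. eventually (\<lambda>s. f' (prod_encode (x, s)) = f x) sequentially"
    using limit_computable_SucE[OF Suc.prems(1)] by blast
  obtain g' where g': "limit_computable m g'"
    "\<And>x. eventually (\<lambda>s. g' (prod_encode (x, s)) = g x) sequentially"
    using limit_computable_SucE[OF Suc.prems(2)] by blast
  \<comment> \<open>The recursion runs with context \<open>(x, s)\<close> instead of \<open>x\<close>, so that every step uses stage \<open>s\<close>.\<close>
  define G where "G = (\<lambda>q. g' (prod_encode (prod_encode (pfst (pfst q), psnd q), psnd (pfst q))))"
  define h where "h = (\<lambda>p. nat_rec_coded f' G
    (prod_encode (prod_encode (pfst (pfst p), psnd p), psnd (pfst p))))"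
  have "limit_computable m G"
    unfolding G_def
    by (intro limit_computable_comp[OF g'(1)] limit_computable_pair limit_computable_pfst
        limit_computable_psnd limit_computable_id)
  then have rec: "limit_computable m (nat_rec_coded f' G)"
    by (rule Suc.IH[OF f'(1)])
  have "limit_computable m h"
    unfolding h_def
    by (intro limit_computable_comp[OF rec] limit_computable_pair
        limit_computable_pfst limit_computable_psnd limit_computable_id)
  moreover have "eventually (\<lambda>s. h (prod_encode (x, s)) = nat_rec_coded f g x) sequentially" for x
  proof -
    have "eventually (\<lambda>s. rec_nat (f' (prod_encode (y, s)))
        (\<lambda>i r. g' (prod_encode (prod_encode (y, prod_encode (i, r)), s))) b
        = rec_nat (f y) (\<lambda>i r. g (prod_encode (y, prod_encode (i, r)))) b) sequentially" for y b
    proof (induction b)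
      case 0
      show ?case using f'(2)[of y] by simp
    next
      case (Suc b)
      let ?r = "rec_nat (f y) (\<lambda>i r. g (prod_encode (y, prod_encode (i, r)))) b"
      from g'(2)[of "prod_encode (y, prod_encode (b, ?r))"] Suc show ?case
        by eventually_elim simp
    qed
    from this[of "pfst x" "psnd x"] show ?thesis
      by (simp add: h_def nat_rec_coded_def G_def)
  qed
  ultimately show ?case by (rule limit_computable_SucI)
qed

section \<open>A calculus for typed functions\<close>

text \<open>Codings are bijections with the natural numbers, so every number is a code and decoding
  needs no validity test.\<close>

class coded =
  fixes code :: "'a \<Rightarrow> nat" and dec :: "nat \<Rightarrow> 'a"
  assumes dec_code [simp]: "dec (code x) = x" and code_dec [simp]: "code (dec n) = n"

instantiation nat :: coded
begin
definition [simp]: "code (n::nat) = n"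
definition [simp]: "dec n = (n::nat)"
instance by standard simp_all
end

instantiation prod :: (coded, coded) coded
begin
definition "code p = prod_encode (code (fst p), code (snd p))"
definition "dec n = (dec (pfst n), dec (psnd n))"
instance by standard (simp_all add: code_prod_def dec_prod_def)
end

instantiation list :: (coded) coded
begin
definition "code xs = list_encode (map code xs)"
definition "dec n = map dec (list_decode n)"
instance by standard (simp_all add: code_list_def dec_list_def comp_def)
end

lemma code_eq_iff: "code x = code y \<longleftrightarrow> x = y"
  by (metis dec_code)

lemma code_Nil [simp]: "code [] = 0"
  and code_Cons [simp]: "code (x # xs) = Suc (prod_encode (code x, code xs))"
  by (simp_all add: code_list_def)

text \<open>This bounds the number of steps of a fold before the length itself is known to be
  computable; \<open>lcomp_length\<close> obtains it from a fold.\<close>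

lemma length_le_code: "length xs \<le> code xs"
  by (induction xs) (auto intro: order_trans[OF _ le_prod_encode_2])

text \<open>
  \<open>lcomp m f\<close> and \<open>ldec m P\<close> say that \<open>f\<close> is computable and \<open>P\<close> decidable with \<open>m\<close> nested limits.
  The rules \<open>lcomp_intros\<close> follow the syntax of the defining term; parameters of bound variables
  are passed by pairing.
\<close>

definition lcomp :: "nat \<Rightarrow> ('a::coded \<Rightarrow> 'b::coded) \<Rightarrow> bool" where
  "lcomp m f \<longleftrightarrow> limit_computable m (\<lambda>n. code (f (dec n)))"

definition ldec :: "nat \<Rightarrow> ('a::coded \<Rightarrow> bool) \<Rightarrow> bool" where
  "ldec m P \<longleftrightarrow> lcomp m (\<lambda>x. if P x then 1 else 0 :: nat)"

named_theorems lcomp_intros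

lemma lcomp_comp: "lcomp m h \<Longrightarrow> lcomp m f \<Longrightarrow> lcomp m (\<lambda>x. h (f x))"
  unfolding lcomp_def by (drule (1) limit_computable_comp) simp

lemma ldec_comp: "ldec m P \<Longrightarrow> lcomp m f \<Longrightarrow> ldec m (\<lambda>x. P (f x))"
  unfolding ldec_def by (rule lcomp_comp)

lemma lcomp_id [lcomp_intros]: "lcomp m (\<lambda>x. x)"
  unfolding lcomp_def by (simp add: limit_computable_id)

lemma lcomp_const [lcomp_intros]: "lcomp m (\<lambda>x. c)"
  unfolding lcomp_def by (intro limit_computable_computable computable_fun_basic)

lemma ldec_const [lcomp_intros]: "ldec m (\<lambda>x. c)"
  unfolding ldec_def by (rule lcomp_const)

lemma lcomp_app:
  assumes "computable_fun F" "\<And>y. F (code y) = code (h y)" "lcomp m f"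
  shows "lcomp m (\<lambda>x. h (f x))"
  using limit_computable_comp[OF limit_computable_computable[OF assms(1)] assms(3)[unfolded lcomp_def]]
  unfolding lcomp_def assms(2) .

lemma lcomp_fst [lcomp_intros]: "lcomp m f \<Longrightarrow> lcomp m (\<lambda>x. fst (f x))"
  by (rule lcomp_app[OF computable_fun_basic(4)]) (simp_all add: code_prod_def)

lemma lcomp_snd [lcomp_intros]: "lcomp m f \<Longrightarrow> lcomp m (\<lambda>x. snd (f x))"
  by (rule lcomp_app[OF computable_fun_basic(5)]) (simp_all add: code_prod_def)

lemma lcomp_Suc [lcomp_intros]: "lcomp m f \<Longrightarrow> lcomp m (\<lambda>x. Suc (f x))"
  by (rule lcomp_app[OF computable_fun_basic(3)]) simp_all

lemma lcomp_pfst [lcomp_intros]: "lcomp m f \<Longrightarrow> lcomp m (\<lambda>x. pfst (f x))"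
  by (rule lcomp_app[OF computable_fun_basic(4)]) simp_all

lemma lcomp_psnd [lcomp_intros]: "lcomp m f \<Longrightarrow> lcomp m (\<lambda>x. psnd (f x))"
  by (rule lcomp_app[OF computable_fun_basic(5)]) simp_all

lemma lcomp_code [lcomp_intros]: "lcomp m f \<Longrightarrow> lcomp m (\<lambda>x. code (f x))"
  by (rule lcomp_app[OF computable_fun_basic(1)]) simp_all

lemma lcomp_dec [lcomp_intros]: "lcomp m f \<Longrightarrow> lcomp m (\<lambda>x. dec (f x))"
  by (rule lcomp_app[OF computable_fun_basic(1)]) simp_all

lemma lcomp_Pair [lcomp_intros]: "lcomp m f \<Longrightarrow> lcomp m g \<Longrightarrow> lcomp m (\<lambda>x. (f x, g x))"
  unfolding lcomp_def code_prod_def by (simp add: limit_computable_pair)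

lemma lcomp_rec_nat [lcomp_intros]:
  fixes a :: "'a::coded \<Rightarrow> 'b::coded"
  assumes a: "lcomp m a" and g: "lcomp m (\<lambda>p. g (fst p) (fst (snd p)) (snd (snd p)))"
    and b: "lcomp m b"
  shows "lcomp m (\<lambda>x. rec_nat (a x) (g x) (b x))"
proof -
  define A where "A = (\<lambda>n. code (a (dec n)))"
  define G where "G = (\<lambda>n. code ((\<lambda>p. g (fst p) (fst (snd p)) (snd (snd p))) (dec n)))"
  have "rec_nat (A n) (\<lambda>i r. G (prod_encode (n, prod_encode (i, r)))) k
      = code (rec_nat (a (dec n)) (g (dec n)) k)" for n k
    by (induction k) (simp_all add: A_def G_def dec_prod_def)
  then have "nat_rec_coded A G (prod_encode (n, code (b (dec n))))
      = code (rec_nat (a (dec n)) (g (dec n)) (b (dec n)))" for n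
    by (simp add: nat_rec_coded_def)
  moreover have "limit_computable m (\<lambda>n. nat_rec_coded A G (prod_encode (n, code (b (dec n)))))"
    using a g b unfolding lcomp_def A_def[symmetric] G_def[symmetric]
    by (intro limit_computable_comp[OF limit_computable_rec] limit_computable_pair
        limit_computable_id)
  ultimately show ?thesis unfolding lcomp_def by simp
qed

lemma lcomp_cong:
  assumes "lcomp m f" "\<And>x. f x = g x"
  shows "lcomp m g"
proof -
  have "f = g" using assms(2) by (rule ext)
  with assms(1) show ?thesis by simp
qed

lemma ldec_cong:
  assumes "ldec m f" "\<And>x. f x = g x"
  shows "ldec m g"
proof -
  have "f = g" using assms(2) by (rule ext)
  with assms(1) show ?thesis by simp
qed

section \<open>Conditionals, arithmetic and bounded search\<close>

lemma lcomp_if [lcomp_intros]: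
  assumes "ldec m P" "lcomp m f" "lcomp m g"
  shows "lcomp m (\<lambda>x. if P x then f x else g x)"
proof (rule lcomp_cong)
  note [lcomp_intros] = assms assms(1)[unfolded ldec_def] lcomp_comp[OF assms(2)]
  \<comment> \<open>A conditional is a recursion whose depth 0 or 1 is the truth value of
    \<open>P x\<close>.\<close>
  show "lcomp m (\<lambda>x. rec_nat (g x) (\<lambda>i r. f x) (if P x then 1 else 0))"
    by (intro lcomp_intros)
qed simp

lemma ldec_if [lcomp_intros]:
  "ldec m P \<Longrightarrow> ldec m Q \<Longrightarrow> ldec m R \<Longrightarrow> ldec m (\<lambda>x. if P x then Q x else R x)"
  unfolding ldec_def[of m "\<lambda>x. if P x then Q x else R x"]
  by (rule lcomp_cong[of m "\<lambda>x. if P x then (if Q x then 1 else 0) else (if R x then 1 else 0)"])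
    (intro lcomp_intros, auto)

lemma ldec_not [lcomp_intros]: "ldec m P \<Longrightarrow> ldec m (\<lambda>x. \<not> P x)"
  by (rule ldec_cong[of m "\<lambda>x. if P x then False else True"]) (intro lcomp_intros, auto)

lemma ldec_conj [lcomp_intros]: "ldec m P \<Longrightarrow> ldec m Q \<Longrightarrow> ldec m (\<lambda>x. P x \<and> Q x)"
  by (rule ldec_cong[of m "\<lambda>x. if P x then Q x else False"]) (intro lcomp_intros, auto)

lemma ldec_disj [lcomp_intros]: "ldec m P \<Longrightarrow> ldec m Q \<Longrightarrow> ldec m (\<lambda>x. P x \<or> Q x)"
  by (rule ldec_cong[of m "\<lambda>x. if P x then True else Q x"]) (intro lcomp_intros, auto)

lemma lcomp_plus [lcomp_intros]:
  fixes f g :: "'a::coded \<Rightarrow> nat"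
  assumes "lcomp m f" "lcomp m g"
  shows "lcomp m (\<lambda>x. f x + g x)"
proof (rule lcomp_cong)
  show "lcomp m (\<lambda>x. rec_nat (f x) (\<lambda>i r. Suc r) (g x))"
    by (intro lcomp_intros assms)
  have "rec_nat a (\<lambda>i r. Suc r) b = a + b" for a b by (induction b) auto
  then show "rec_nat (f x) (\<lambda>i r. Suc r) (g x) = f x + g x" for x by simp
qed

lemma lcomp_diff [lcomp_intros]:
  fixes f g :: "'a::coded \<Rightarrow> nat"
  assumes "lcomp m f" "lcomp m g"
  shows "lcomp m (\<lambda>x. f x - g x)"
proof (rule lcomp_cong)
  have pred: "lcomp m (\<lambda>x. f x - 1)" if "lcomp m f" for f :: "'b::coded \<Rightarrow> nat"
    using that by (rule lcomp_app[OF computable_fun_basic(6), rotated]) simp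
  show "lcomp m (\<lambda>x. rec_nat (f x) (\<lambda>i r. r - 1) (g x))"
    by (intro lcomp_intros pred assms)
  have "rec_nat a (\<lambda>i r. r - 1) b = a - b" for a b :: nat by (induction b) auto
  then show "rec_nat (f x) (\<lambda>i r. r - 1) (g x) = f x - g x" for x by simp
qed

lemma lcomp_times [lcomp_intros]:
  fixes f g :: "'a::coded \<Rightarrow> nat"
  assumes "lcomp m f" "lcomp m g"
  shows "lcomp m (\<lambda>x. f x * g x)"
proof (rule lcomp_cong)
  show "lcomp m (\<lambda>x. rec_nat 0 (\<lambda>i r. r + f x) (g x))"
    by (intro lcomp_intros assms lcomp_comp[OF assms(1)])
  have "rec_nat 0 (\<lambda>i r. r + a) b = a * b" for a b :: nat by (induction b) auto
  then show "rec_nat 0 (\<lambda>i r. r + f x) (g x) = f x * g x" for x by simp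
qed

lemma lcomp_power [lcomp_intros]:
  fixes f g :: "'a::coded \<Rightarrow> nat"
  assumes "lcomp m f" "lcomp m g"
  shows "lcomp m (\<lambda>x. f x ^ g x)"
proof (rule lcomp_cong)
  show "lcomp m (\<lambda>x. rec_nat 1 (\<lambda>i r. r * f x) (g x))"
    by (intro lcomp_intros assms lcomp_comp[OF assms(1)])
  have "rec_nat 1 (\<lambda>i r. r * a) b = a ^ b" for a b :: nat by (induction b) auto
  then show "rec_nat 1 (\<lambda>i r. r * f x) (g x) = f x ^ g x" for x by simp
qed

lemma ldec_less [lcomp_intros]:
  fixes f g :: "'a::coded \<Rightarrow> nat"
  assumes "lcomp m f" "lcomp m g"
  shows "ldec m (\<lambda>x. f x < g x)"
  unfolding ldec_def
proof (rule lcomp_cong)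
  show "lcomp m (\<lambda>x. rec_nat 0 (\<lambda>i r. 1) (g x - f x))"
    by (intro lcomp_intros assms)
  show "rec_nat 0 (\<lambda>i r. 1) (g x - f x) = (if f x < g x then 1 else 0)" for x
    by (cases "g x - f x") auto
qed

lemma ldec_eq [lcomp_intros]:
  fixes f g :: "'a::coded \<Rightarrow> 'b::coded"
  assumes "lcomp m f" "lcomp m g"
  shows "ldec m (\<lambda>x. f x = g x)"
proof (rule ldec_cong)
  show "ldec m (\<lambda>x. \<not> code (f x) < code (g x) \<and> \<not> code (g x) < code (f x))"
    by (intro lcomp_intros assms)
  show "(\<not> code (f x) < code (g x) \<and> \<not> code (g x) < code (f x)) = (f x = g x)" for x
    using code_eq_iff[of "f x" "g x"] by auto
qed

lemma ldec_bex [lcomp_intros]: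
  fixes P :: "'a::coded \<Rightarrow> nat \<Rightarrow> bool"
  assumes "ldec m (\<lambda>p. P (fst p) (snd p))" "lcomp m b"
  shows "ldec m (\<lambda>x. \<exists>i<b x. P x i)"
  unfolding ldec_def
proof (rule lcomp_cong)
  show "lcomp m (\<lambda>x. rec_nat (0 :: nat) (\<lambda>i r. if P x i then 1 else r) (b x))"
    using ldec_comp[OF assms(1), of "\<lambda>p. (fst p, fst (snd p))"]
    by (intro lcomp_intros assms) (simp_all add: lcomp_intros)
  have "rec_nat 0 (\<lambda>i r. if P x i then 1 else r) k = (if \<exists>i<k. P x i then 1 else 0 :: nat)" for x k
    by (induction k) (auto simp: less_Suc_eq)
  then show "rec_nat (0 :: nat) (\<lambda>i r. if P x i then 1 else r) (b x) = (if \<exists>i<b x. P x i then 1 else 0)" for x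
    by simp
qed

lemma ldec_ball [lcomp_intros]:
  fixes P :: "'a::coded \<Rightarrow> nat \<Rightarrow> bool"
  assumes "ldec m (\<lambda>p. P (fst p) (snd p))" "lcomp m b"
  shows "ldec m (\<lambda>x. \<forall>i<b x. P x i)"
proof (rule ldec_cong)
  show "ldec m (\<lambda>x. \<not> (\<exists>i<b x. \<not> P x i))"
    by (intro lcomp_intros assms)
qed auto

text \<open>The disjunct \<open>i = b x\<close> makes the search bounded, with \<open>b x\<close> as
  the result of a failed search. The recursion counts how long \<open>P\<close> keeps
  failing.\<close>

lemma lcomp_Least [lcomp_intros]:
  fixes P :: "'a::coded \<Rightarrow> nat \<Rightarrow> bool"
  assumes "ldec m (\<lambda>p. P (fst p) (snd p))" "lcomp m b"
  shows "lcomp m (\<lambda>x. LEAST i. i = b x \<or> P x i)"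
proof (rule lcomp_cong)
  show "lcomp m (\<lambda>x. rec_nat 0 (\<lambda>i r. if \<forall>j<Suc i. \<not> P x j then Suc r else r) (b x))"
    using ldec_comp[OF assms(1), of "\<lambda>p. (fst (fst p), snd p)"]
    by (intro lcomp_intros assms) (simp_all add: lcomp_intros)
  fix x
  have "rec_nat 0 (\<lambda>i r. if \<forall>j<Suc i. \<not> P x j then Suc r else r) k
      = (LEAST i. i = k \<or> P x i)" for k
  proof (induction k)
    case 0
    show ?case by (auto intro: Least_equality[symmetric])
  next
    case (Suc k)
    show ?case
    proof (cases "\<forall>j<Suc k. \<not> P x j")
      case True
      then have "\<And>i. P x i \<Longrightarrow> Suc k \<le> i" by (meson not_le)
      then have "(LEAST i. i = k \<or> P x i) = k" "(LEAST i. i = Suc k \<or> P x i) = Suc k"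
        by (auto intro!: Least_equality dest: Suc_leD)
      with True Suc show ?thesis by simp
    next
      case False
      then obtain j where j: "j \<le> k" "P x j" by (auto simp: less_Suc_eq_le)
      define l where "l = (LEAST i. P x i)"
      have l: "P x l" "l \<le> k" "\<And>i. P x i \<Longrightarrow> l \<le> i"
        unfolding l_def using j by (auto intro: LeastI Least_le order_trans)
      then have "(LEAST i. i = k \<or> P x i) = l" "(LEAST i. i = Suc k \<or> P x i) = l"
        by (auto intro!: Least_equality)
      with False Suc show ?thesis by simp
    qed
  qed
  then show "rec_nat 0 (\<lambda>i r. if \<forall>j<Suc i. \<not> P x j then Suc r else r) (b x)
      = (LEAST i. i = b x \<or> P x i)"
    by simp
qed

section \<open>Operations on lists\<close>

lemma lcomp_Cons [lcomp_intros]: "lcomp m f \<Longrightarrow> lcomp m g \<Longrightarrow> lcomp m (\<lambda>x. f x # g x)"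
  using lcomp_app[of "Suc" "\<lambda>p. fst p # snd p" m "\<lambda>x. (f x, g x)"]
  by (simp add: computable_fun_basic code_prod_def lcomp_Pair)

lemma lcomp_tl [lcomp_intros]: "lcomp m f \<Longrightarrow> lcomp m (\<lambda>x. tl (f x))"
proof (rule lcomp_app[where h = tl])
  show "computable_fun (\<lambda>n. psnd (n - 1))"
    by (rule computable_fun_comp[OF computable_fun_basic(5) computable_fun_basic(6)])
  \<comment> \<open>The empty list has code 0, and \<open>psnd 0 = 0\<close> makes it its own
    tail.\<close>
  have "psnd (prod_encode (0, 0)) = 0" unfolding psnd_prod_encode by simp
  then have "psnd 0 = 0" by (simp add: prod_encode_def)
  then show "psnd (code xs - 1) = code (tl xs)" for xs :: "'b list"
    by (cases xs) auto
qed

lemma lcomp_hd [lcomp_intros]: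
  assumes "lcomp m f"
  shows "lcomp m (\<lambda>x. hd (f x))"
proof (rule lcomp_cong)
  \<comment> \<open>The value of \<open>hd []\<close> is unspecified but fixed, so on the empty list
    a constant is returned.\<close>
  show "lcomp m (\<lambda>x. if f x = [] then hd [] else dec (pfst (code (f x) - 1)))"
    by (intro lcomp_intros assms)
  show "(if f x = [] then hd [] else dec (pfst (code (f x) - 1))) = hd (f x)" for x
    by (cases "f x") auto
qed

lemma lcomp_drop [lcomp_intros]:
  assumes "lcomp m f" "lcomp m n"
  shows "lcomp m (\<lambda>x. drop (n x) (f x))"
proof (rule lcomp_cong)
  show "lcomp m (\<lambda>x. rec_nat (f x) (\<lambda>i r. tl r) (n x))"
    by (intro lcomp_intros assms)
  have "rec_nat xs (\<lambda>i r. tl r) k = drop k xs" for xs :: "'b list" and k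
    by (induction k) (auto simp: tl_drop drop_Suc)
  then show "rec_nat (f x) (\<lambda>i r. tl r) (n x) = drop (n x) (f x)" for x
    by simp
qed

lemma lcomp_fold [lcomp_intros]:
  assumes g: "lcomp m (\<lambda>p. g (fst p) (fst (snd p)) (snd (snd p)))"
    and f: "lcomp m f" and a: "lcomp m a"
  shows "lcomp m (\<lambda>x. fold (g x) (f x) (a x))"
proof (rule lcomp_cong)
  \<comment> \<open>The state is the remaining list with the accumulator. It stops changing when the
    list is exhausted, so running too many steps does no harm.\<close>
  let ?step = "\<lambda>x r. if fst r = [] then r else (tl (fst r), g x (hd (fst r)) (snd r))"
  have "lcomp m (\<lambda>p. g (fst p) (hd (fst (snd (snd p)))) (snd (snd (snd p))))"
    using lcomp_comp[OF g, of "\<lambda>p. (fst p, hd (fst (snd (snd p))), snd (snd (snd p)))"]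
    by (simp add: lcomp_intros)
  then show "lcomp m (\<lambda>x. snd (rec_nat (f x, a x) (\<lambda>i r. ?step x r) (code (f x))))"
    by (intro lcomp_intros f a)
  fix x
  have "rec_nat (xs, b) (\<lambda>i r. ?step x r) k = (drop k xs, fold (g x) (take k xs) b)" for xs b k
  proof (induction k)
    case (Suc k)
    show ?case
    proof (cases "k < length xs")
      case True
      then show ?thesis
        using Suc by (simp add: take_Suc_conv_app_nth hd_drop_conv_nth tl_drop drop_Suc)
    qed (use Suc in simp)
  qed simp
  then show "snd (rec_nat (f x, a x) (\<lambda>i r. ?step x r) (code (f x))) = fold (g x) (f x) (a x)"
    using length_le_code[of "f x"] by simp
qed

lemma lcomp_length [lcomp_intros]:
  assumes "lcomp m f"
  shows "lcomp m (\<lambda>x. length (f x))"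
proof (rule lcomp_cong)
  show "lcomp m (\<lambda>x. fold (\<lambda>_ r. Suc r) (f x) 0)"
    by (intro lcomp_intros assms)
  have "fold (\<lambda>_ r. Suc r) xs a = length xs + a" for xs :: "'b list" and a
    by (induction xs arbitrary: a) auto
  then show "fold (\<lambda>_ r. Suc r) (f x) 0 = length (f x)" for x by simp
qed

lemma lcomp_rev [lcomp_intros]:
  assumes "lcomp m f"
  shows "lcomp m (\<lambda>x. rev (f x))"
proof (rule lcomp_cong)
  show "lcomp m (\<lambda>x. fold (\<lambda>y ys. y # ys) (f x) [])"
    by (intro lcomp_intros assms)
qed (simp add: fold_Cons_rev)

lemma lcomp_append [lcomp_intros]:
  assumes "lcomp m f" "lcomp m g"
  shows "lcomp m (\<lambda>x. f x @ g x)"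
proof (rule lcomp_cong)
  show "lcomp m (\<lambda>x. fold (\<lambda>y ys. y # ys) (rev (f x)) (g x))"
    by (intro lcomp_intros assms)
qed (simp add: fold_Cons_rev)

lemma ldec_Bex_set [lcomp_intros]:
  assumes P: "ldec m (\<lambda>p. P (fst p) (snd p))" and f: "lcomp m f"
  shows "ldec m (\<lambda>x. \<exists>y\<in>set (f x). P x y)"
  unfolding ldec_def
proof (rule lcomp_cong)
  show "lcomp m (\<lambda>x. fold (\<lambda>y r. if P x y then 1 else r) (f x) (0 :: nat))"
    using ldec_comp[OF P, of "\<lambda>p. (fst p, fst (snd p))"]
    by (intro lcomp_intros f) (simp_all add: lcomp_intros)
  have "fold (\<lambda>y r. if P x y then 1 else r) ys a = (if \<exists>y\<in>set ys. P x y then 1 else a)" for x ys and a :: nat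
    by (induction ys arbitrary: a) auto
  then show "fold (\<lambda>y r. if P x y then 1 else r) (f x) (0 :: nat) = (if \<exists>y\<in>set (f x). P x y then 1 else 0)"
    for x by simp
qed

lemma ldec_Ball_set [lcomp_intros]:
  assumes "ldec m (\<lambda>p. P (fst p) (snd p))" "lcomp m f"
  shows "ldec m (\<lambda>x. \<forall>y\<in>set (f x). P x y)"
proof (rule ldec_cong)
  show "ldec m (\<lambda>x. \<not> (\<exists>y\<in>set (f x). \<not> P x y))"
    by (intro lcomp_intros assms)
qed auto

lemma ldec_in_set [lcomp_intros]:
  assumes "lcomp m f" "lcomp m g"
  shows "ldec m (\<lambda>x. g x \<in> set (f x))"
proof (rule ldec_cong)
  show "ldec m (\<lambda>x. \<exists>y\<in>set (f x). y = g x)"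
    by (intro lcomp_intros assms lcomp_comp[OF assms(2)])
qed auto

text \<open>At stage \<open>s\<close> a witness is sought below \<open>s\<close>. The answer changes
  at most once, when the first witness comes into range, so an unbounded quantifier costs one
  limit.\<close>

lemma ldec_Suc_Ex:
  assumes "ldec m (\<lambda>p. P (fst p) (snd p))"
  shows "ldec (Suc m) (\<lambda>x. \<exists>y::nat. P x y)"
proof -
  have "ldec m (\<lambda>p. \<exists>y<snd p. P (fst p) y)"
    using ldec_comp[OF assms, of "\<lambda>p. (fst (fst p), snd p)"]
    by (intro lcomp_intros) (simp_all add: lcomp_intros)
  then have "limit_computable m (\<lambda>n. if \<exists>y<psnd n. P (dec (pfst n)) y then 1 else 0)"
    by (simp add: ldec_def lcomp_def dec_prod_def)
  moreover have "eventually (\<lambda>s. (if \<exists>y<psnd (prod_encode (n, s)). P (dec (pfst (prod_encode (n, s)))) y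
      then 1 else 0) = (if \<exists>y. P (dec n) y then 1 else 0 :: nat)) sequentially" for n
  proof (cases "\<exists>y. P (dec n) y")
    case True
    then obtain y where "P (dec n) y" ..
    then show ?thesis
      by (intro eventually_mono[OF eventually_gt_at_top[of y]]) auto
  qed auto
  ultimately show ?thesis
    unfolding ldec_def lcomp_def code_nat_def by (rule limit_computable_SucI)
qed

lemma ldec_Suc_All:
  assumes "ldec m (\<lambda>p. P (fst p) (snd p))"
  shows "ldec (Suc m) (\<lambda>x. \<forall>y::nat. P x y)"
proof (rule ldec_cong)
  show "ldec (Suc m) (\<lambda>x. \<not> (\<exists>y. \<not> P x y))"
    by (intro ldec_not ldec_Suc_Ex assms)
qed auto

section \<open>A universal predicate\<close>

primrec recf_code :: "recf \<Rightarrow> nat" where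
  "recf_code Zero = prod_encode (0, 0)"
| "recf_code Succ = prod_encode (1, 0)"
| "recf_code (Proj i) = prod_encode (2, i)"
| "recf_code (Comp f gs) = prod_encode (3, prod_encode (recf_code f, list_encode (map recf_code gs)))"
| "recf_code (PrimRec f g) = prod_encode (4, prod_encode (recf_code f, recf_code g))"
| "recf_code (Mu f) = prod_encode (5, recf_code f)"

text \<open>
  A triple \<open>(e, xs, y)\<close> claims that the term coded by \<open>e\<close> maps \<open>xs\<close> to \<open>y\<close>; it is justified by
  a list of claims if it follows from them by one rule. The premises of a rule concern smaller terms,
  or the same term with smaller first argument, so a list justifying all of its members
  cannot be circular.
\<close>

type_synonym claim = "nat \<times> nat list \<times> nat"

definition justified :: "claim list \<Rightarrow> claim \<Rightarrow> bool" where
  "justified D j =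
    (let e = fst j; xs = fst (snd j); y = snd (snd j); b = psnd e; gs = dec (psnd b) :: nat list in
      pfst e = 0 \<and> y = 0 \<or>
      pfst e = 1 \<and> xs \<noteq> [] \<and> tl xs = [] \<and> y = Suc (hd xs) \<or>
      pfst e = 2 \<and> drop b xs \<noteq> [] \<and> y = hd (drop b xs) \<or>
      pfst e = 3 \<and> (\<exists>t\<in>set D. fst t = pfst b \<and> snd (snd t) = y \<and> length (fst (snd t)) = length gs \<and>
        (\<forall>i<length gs. (hd (drop i gs), xs, hd (drop i (fst (snd t)))) \<in> set D)) \<or>
      pfst e = 4 \<and> xs \<noteq> [] \<and> hd xs = 0 \<and> (pfst b, tl xs, y) \<in> set D \<or>
      pfst e = 4 \<and> xs \<noteq> [] \<and> hd xs \<noteq> 0 \<and> (\<exists>t\<in>set D. fst t = e \<and> fst (snd t) = (hd xs - 1) # tl xs \<and>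
        (psnd b, (hd xs - 1) # snd (snd t) # tl xs, y) \<in> set D) \<or>
      pfst e = 5 \<and> (b, y # xs, 0) \<in> set D \<and>
        (\<forall>i<y. \<exists>t\<in>set D. fst t = b \<and> fst (snd t) = i # xs \<and> snd (snd t) \<noteq> 0))"

text \<open>Matches the disjuncts of \<open>justified\<close> with the rules of
  \<open>evaluates\<close>, so that all decoding is done here once and for all.\<close>

lemma justified_simps:
  "justified D (recf_code Zero, xs, y) \<longleftrightarrow> y = 0"
  "justified D (recf_code Succ, xs, y) \<longleftrightarrow> (\<exists>x. xs = [x] \<and> y = Suc x)"
  "justified D (recf_code (Proj i), xs, y) \<longleftrightarrow> i < length xs \<and> y = xs ! i"
  "justified D (recf_code (Comp f gs), xs, y) \<longleftrightarrow>
     (\<exists>ys. (recf_code f, ys, y) \<in> set D \<and> length ys = length gs \<and>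
       (\<forall>i<length gs. (recf_code (gs ! i), xs, ys ! i) \<in> set D))"
  "justified D (recf_code (PrimRec f g), [], y) \<longleftrightarrow> False"
  "justified D (recf_code (PrimRec f g), 0 # zs, y) \<longleftrightarrow> (recf_code f, zs, y) \<in> set D"
  "justified D (recf_code (PrimRec f g), Suc m # zs, y) \<longleftrightarrow>
     (\<exists>r. (recf_code (PrimRec f g), m # zs, r) \<in> set D \<and> (recf_code g, m # r # zs, y) \<in> set D)"
  "justified D (recf_code (Mu f), xs, y) \<longleftrightarrow>
     (recf_code f, y # xs, 0) \<in> set D \<and> (\<forall>i<y. \<exists>z. (recf_code f, i # xs, Suc z) \<in> set D)"
proof -
  show "justified D (recf_code Succ, xs, y) \<longleftrightarrow> (\<exists>x. xs = [x] \<and> y = Suc x)"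
    by (cases xs) (auto simp: justified_def)
  show "justified D (recf_code (Proj i), xs, y) \<longleftrightarrow> i < length xs \<and> y = xs ! i"
    by (auto simp: justified_def hd_drop_conv_nth)
  define Q where "Q ys \<longleftrightarrow> length ys = length (map recf_code gs) \<and>
    (\<forall>i<length (map recf_code gs). (hd (drop i (map recf_code gs)), xs, hd (drop i ys)) \<in> set D)" for ys
  have "justified D (recf_code (Comp f gs), xs, y) \<longleftrightarrow>
      (\<exists>t\<in>set D. fst t = recf_code f \<and> snd (snd t) = y \<and> Q (fst (snd t)))"
    by (simp add: justified_def Let_def dec_list_def comp_def Q_def)
  also have "\<dots> \<longleftrightarrow> (\<exists>ys. (recf_code f, ys, y) \<in> set D \<and> Q ys)"
    by force
  also have "\<dots> \<longleftrightarrow> (\<exists>ys. (recf_code f, ys, y) \<in> set D \<and> length ys = length gs \<and>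
       (\<forall>i<length gs. (recf_code (gs ! i), xs, ys ! i) \<in> set D))"
    by (intro ex_cong1 conj_cong refl) (auto simp: Q_def hd_drop_conv_nth)
  finally show "justified D (recf_code (Comp f gs), xs, y) \<longleftrightarrow>
     (\<exists>ys. (recf_code f, ys, y) \<in> set D \<and> length ys = length gs \<and>
       (\<forall>i<length gs. (recf_code (gs ! i), xs, ys ! i) \<in> set D))" .
  show "justified D (recf_code (Mu f), xs, y) \<longleftrightarrow>
     (recf_code f, y # xs, 0) \<in> set D \<and> (\<forall>i<y. \<exists>z. (recf_code f, i # xs, Suc z) \<in> set D)"
    by (auto simp: justified_def Let_def gr0_conv_Suc Bex_def)
  show "justified D (recf_code (PrimRec f g), Suc m # zs, y) \<longleftrightarrow>
     (\<exists>r. (recf_code (PrimRec f g), m # zs, r) \<in> set D \<and> (recf_code g, m # r # zs, y) \<in> set D)"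
    by (force simp: justified_def Let_def)
qed (simp_all add: justified_def)

lemma ldec_justified: "lcomp m f \<Longrightarrow> lcomp m g \<Longrightarrow> ldec m (\<lambda>x. justified (f x) (g x))"
proof -
  have *: "ldec m (\<lambda>p. justified (fst p) (snd p))"
    unfolding justified_def Let_def by (intro lcomp_intros)
  show "lcomp m f \<Longrightarrow> lcomp m g \<Longrightarrow> ?thesis"
    using ldec_comp[OF *, of "\<lambda>x. (f x, g x)"] by (simp add: lcomp_Pair)
qed

section \<open>Soundness and completeness of derivations\<close>

definition self_justified :: "claim list \<Rightarrow> bool" where
  "self_justified D \<longleftrightarrow> (\<forall>t\<in>set D. justified D t)"

text \<open>Induction on the term. For \<open>PrimRec\<close> a premise may concern the same term,
  and an inner induction on the first argument takes over.\<close>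

lemma self_justified_sound:
  assumes D: "self_justified D"
  shows "(recf_code e, xs, y) \<in> set D \<Longrightarrow> evaluates e xs y"
proof (induction e arbitrary: xs y)
  case Zero
  with D have "justified D (recf_code Zero, xs, y)" unfolding self_justified_def by blast
  then show ?case unfolding justified_simps by (auto intro: evaluates_Zero)
next
  case Succ
  with D have "justified D (recf_code Succ, xs, y)" unfolding self_justified_def by blast
  then show ?case unfolding justified_simps by (auto intro: evaluates_Succ)
next
  case (Proj i)
  with D have "justified D (recf_code (Proj i), xs, y)" unfolding self_justified_def by blast
  then show ?case unfolding justified_simps by (auto intro: evaluates_Proj)
next
  case (Comp f gs)
  with D have "justified D (recf_code (Comp f gs), xs, y)" unfolding self_justified_def by blast
  then obtain ys where "(recf_code f, ys, y) \<in> set D" "length ys = length gs"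
      "\<And>i. i < length gs \<Longrightarrow> (recf_code (gs ! i), xs, ys ! i) \<in> set D"
    unfolding justified_simps by blast
  with Comp.IH show ?case
    by (intro evaluates_Comp[of xs gs ys f y]) (auto simp: list_all2_conv_all_nth)
next
  case (PrimRec f g)
  have "evaluates (PrimRec f g) (m # zs) y" if "(recf_code (PrimRec f g), m # zs, y) \<in> set D" for m zs y
    using that
  proof (induction m arbitrary: y)
    case 0
    with D have "justified D (recf_code (PrimRec f g), 0 # zs, y)" unfolding self_justified_def by blast
    then show ?case unfolding justified_simps by (intro evaluates_PrimRec_0 PrimRec.IH)
  next
    case (Suc m)
    with D have "justified D (recf_code (PrimRec f g), Suc m # zs, y)"
      unfolding self_justified_def by blast
    then show ?case unfolding justified_simps
      by (auto intro: evaluates_PrimRec_Suc Suc.IH PrimRec.IH simp del: recf_code.simps)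
  qed
  moreover have "xs \<noteq> []"
    using D PrimRec.prems justified_simps(5) unfolding self_justified_def by blast
  ultimately show ?case using PrimRec.prems by (cases xs) auto
next
  case (Mu f)
  with D have "justified D (recf_code (Mu f), xs, y)" unfolding self_justified_def by blast
  then show ?case unfolding justified_simps by (auto intro!: evaluates_Mu Mu.IH)
qed

text \<open>Membership in \<open>D\<close> occurs only positively in \<open>justified\<close>; hence
  lists of claims can be merged freely.\<close>

lemma justified_mono: "justified D t \<Longrightarrow> set D \<subseteq> set D' \<Longrightarrow> justified D' t"
  unfolding justified_def Let_def Bex_def
  by (elim disj_forward conj_forward ex_forward all_forward imp_forward) (assumption | erule (1) subsetD)+

lemma self_justified_concat:
  assumes "\<And>D. D \<in> set Ds \<Longrightarrow> self_justified D"
  shows "self_justified (concat Ds)"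
  unfolding self_justified_def
proof
  fix t
  assume "t \<in> set (concat Ds)"
  then obtain D where "D \<in> set Ds" "t \<in> set D" by auto
  then have "justified D t" "set D \<subseteq> set (concat Ds)"
    using assms unfolding self_justified_def by auto
  then show "justified (concat Ds) t" by (rule justified_mono)
qed

lemma self_justified_Cons:
  assumes "self_justified D" "justified D t"
  shows "self_justified (t # D)"
proof -
  have "justified (t # D) u" if "justified D u" for u
    using that by (rule justified_mono) auto
  with assms show ?thesis unfolding self_justified_def by auto
qed

lemma self_justified_append:
  "self_justified D \<Longrightarrow> self_justified D' \<Longrightarrow> self_justified (D @ D')"
  using self_justified_concat[of "[D, D']"] by auto

text \<open>Every rule has finitely many premises. The lists obtained for them are joined, and the
  conclusion is put in front.\<close>

lemma self_justified_complete:
  "evaluates e xs y \<Longrightarrow> \<exists>D. self_justified D \<and> (recf_code e, xs, y) \<in> set D"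
proof (induction rule: evaluates.induct)
  case (evaluates_Zero xs)
  show ?case
    by (intro exI[of _ "[(recf_code Zero, xs, 0)]"])
      (simp add: self_justified_def justified_simps del: recf_code.simps)
next
  case (evaluates_Succ x)
  show ?case
    by (intro exI[of _ "[(recf_code Succ, [x], Suc x)]"])
      (simp add: self_justified_def justified_simps del: recf_code.simps)
next
  case (evaluates_Proj i xs)
  then show ?case
    by (intro exI[of _ "[(recf_code (Proj i), xs, xs ! i)]"])
      (simp add: self_justified_def justified_simps del: recf_code.simps)
next
  case (evaluates_Comp xs gs ys f y)
  then have len: "length ys = length gs"
    and "\<And>i. i < length gs \<Longrightarrow> \<exists>D. self_justified D \<and> (recf_code (gs ! i), xs, ys ! i) \<in> set D"
    by (auto simp: list_all2_conv_all_nth)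
  then obtain Ds where Ds: "\<And>i. i < length gs \<Longrightarrow> self_justified (Ds i)"
      "\<And>i. i < length gs \<Longrightarrow> (recf_code (gs ! i), xs, ys ! i) \<in> set (Ds i)"
    by metis
  obtain D where D: "self_justified D" "(recf_code f, ys, y) \<in> set D"
    using evaluates_Comp.IH by blast
  let ?D = "D @ concat (map Ds [0..<length gs])"
  have "self_justified ?D"
    using Ds(1) by (intro self_justified_append self_justified_concat D) auto
  moreover have "justified ?D (recf_code (Comp f gs), xs, y)"
    unfolding justified_simps using D(2) Ds(2) len by (intro exI[of _ ys]) force
  ultimately show ?case
    by (intro exI[of _ "(recf_code (Comp f gs), xs, y) # ?D"] conjI self_justified_Cons) auto
next
  case (evaluates_PrimRec_0 f xs y g)
  then obtain D where D: "self_justified D" "(recf_code f, xs, y) \<in> set D" by blast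
  then show ?case
    by (intro exI[of _ "(recf_code (PrimRec f g), 0 # xs, y) # D"])
      (auto intro!: self_justified_Cons simp: justified_simps simp del: recf_code.simps)
next
  case (evaluates_PrimRec_Suc f g m xs r y)
  then obtain D D' where "self_justified D" "(recf_code (PrimRec f g), m # xs, r) \<in> set D"
    "self_justified D'" "(recf_code g, m # r # xs, y) \<in> set D'" by blast
  then show ?case
    by (intro exI[of _ "(recf_code (PrimRec f g), Suc m # xs, y) # D @ D'"])
      (auto intro!: self_justified_Cons self_justified_append simp: justified_simps
        simp del: recf_code.simps)
next
  case (evaluates_Mu f m xs)
  then have "\<forall>i<m. \<exists>z D. self_justified D \<and> (recf_code f, i # xs, Suc z) \<in> set D" by blast
  then obtain Ds z where Ds: "\<And>i. i < m \<Longrightarrow> self_justified (Ds i)"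
      "\<And>i. i < m \<Longrightarrow> (recf_code f, i # xs, Suc (z i)) \<in> set (Ds i)"
    by metis
  obtain D where D: "self_justified D" "(recf_code f, m # xs, 0) \<in> set D"
    using evaluates_Mu.IH by blast
  let ?D = "D @ concat (map Ds [0..<m])"
  have "self_justified ?D"
    using Ds(1) by (intro self_justified_append self_justified_concat D) auto
  moreover have "justified ?D (recf_code (Mu f), xs, m)"
    unfolding justified_simps using D(2) Ds(2) by force
  ultimately show ?case
    by (intro exI[of _ "(recf_code (Mu f), xs, m) # ?D"] conjI self_justified_Cons) auto
qed

text \<open>A decidable relation from which \<open>evaluates\<close> arises by one unbounded search
  over \<open>D\<close>.\<close>

definition derivation :: "nat \<Rightarrow> nat list \<Rightarrow> nat \<Rightarrow> claim list \<Rightarrow> bool" where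
  "derivation e xs y D \<longleftrightarrow> self_justified D \<and> (e, xs, y) \<in> set D"

lemma evaluates_iff_derivation: "evaluates e xs y \<longleftrightarrow> (\<exists>D. derivation (recf_code e) xs y D)"
  unfolding derivation_def using self_justified_sound self_justified_complete by blast

section \<open>Arithmetical sets as iterated limits\<close>

text \<open>
  The innermost quantifier absorbs the search for a derivation: the last entry codes both
  the quantified number and the derivation. A claim that \<open>R\<close> holds is witnessed by a derivation
  of the value 1, a claim that it fails by one of the value 0.
\<close>

definition matrix :: "bool \<Rightarrow> nat \<Rightarrow> nat list \<Rightarrow> bool" where
  "matrix b e zs =
    (let v = hd (rev zs); xs = rev (tl (rev zs)) @ [pfst v]; D = dec (psnd v) in
      if b then derivation e xs 1 D else \<not> derivation e xs 0 D)"

lemma ldec_matrix: "ldec m (\<lambda>p. matrix b (fst p) (snd p))"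
  unfolding matrix_def Let_def derivation_def self_justified_def
  by (intro lcomp_intros ldec_justified)

lemma ldec_prefixes:
  fixes R :: "nat \<Rightarrow> nat list \<Rightarrow> bool"
  assumes "ldec 0 (\<lambda>p. R (fst p) (snd p))"
  shows "ldec m (\<lambda>p. ex_prefix m (R (fst p)) (snd p))"
    and "ldec m (\<lambda>p. all_prefix m (R (fst p)) (snd p))"
proof (induction m)
  case 0
  { case 1 show ?case using assms by simp }
  { case 2 show ?case using assms by simp }
next
  case (Suc m)
  have app: "lcomp m (\<lambda>q::(nat \<times> nat list) \<times> nat. (fst (fst q), snd (fst q) @ [snd q]))"
    by (intro lcomp_intros)
  { case 1
    show ?case
      using ldec_comp[OF Suc(2) app] unfolding ex_prefix.simps
      by (intro ldec_Suc_Ex) simp }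
  { case 2
    show ?case
      using ldec_comp[OF Suc(1) app] unfolding all_prefix.simps
      by (intro ldec_Suc_All) simp }
qed

text \<open>The parity of \<open>m\<close> tells whether the innermost of the \<open>Suc m\<close>
  quantifiers is existential. If so, it absorbs a search for the value 1; if it is universal, it
  absorbs the statement that no derivation gives the value 0. The length condition ensures that
  \<open>R\<close> is reached with exactly \<open>n\<close> arguments, where \<open>e\<close>
  decides it.\<close>

lemma matrix_prefixes:
  fixes R :: "nat list \<Rightarrow> bool" and xs :: "nat list"
  assumes e: "\<And>xs. length xs = n \<Longrightarrow> evaluates e xs (if R xs then 1 else 0)"
  shows "length xs + Suc m = n \<Longrightarrow>
      ex_prefix (Suc m) R xs \<longleftrightarrow> ex_prefix (Suc m) (matrix (even m) (recf_code e)) xs"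
    and "length xs + Suc m = n \<Longrightarrow>
      all_prefix (Suc m) R xs \<longleftrightarrow> all_prefix (Suc m) (matrix (odd m) (recf_code e)) xs"
proof (induction m arbitrary: xs)
  case 0
  have eval: "evaluates e ys v \<longleftrightarrow> v = (if R ys then 1 else 0)" if "length ys = n" for ys v
    using evaluates_deterministic e[OF that] by blast
  \<comment> \<open>A single number ranges over all pairs of a number and a derivation.\<close>
  have dec: "(\<exists>v. P (pfst v) (dec (psnd v))) \<longleftrightarrow> (\<exists>y D. P y D)" for P :: "nat \<Rightarrow> claim list \<Rightarrow> bool"
  proof
    assume "\<exists>y D. P y D"
    then obtain y D where "P y D" by blast
    then show "\<exists>v. P (pfst v) (dec (psnd v))"
      by (intro exI[of _ "prod_encode (y, code D)"]) simp
  qed blast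
  have snoc: "matrix b e' (xs @ [v]) = (if b then derivation e' (xs @ [pfst v]) 1 (dec (psnd v))
      else \<not> derivation e' (xs @ [pfst v]) 0 (dec (psnd v)))" for b e' xs v
    by (simp add: matrix_def)
  { case 1
    then have "(\<exists>y. R (xs @ [y])) \<longleftrightarrow> (\<exists>y. evaluates e (xs @ [y]) 1)"
      by (simp add: eval)
    also have "\<dots> \<longleftrightarrow> (\<exists>v. matrix True (recf_code e) (xs @ [v]))"
      unfolding evaluates_iff_derivation snoc if_True
      by (rule dec[of "\<lambda>y. derivation (recf_code e) (xs @ [y]) 1", symmetric])
    finally show ?case by simp }
  { case 2
    \<comment> \<open>The universal case is proved through its negation, again an existential
      search.\<close>
    then have "(\<exists>y. \<not> R (xs @ [y])) \<longleftrightarrow> (\<exists>y. evaluates e (xs @ [y]) 0)"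
      by (simp add: eval)
    also have "\<dots> \<longleftrightarrow> (\<exists>v. \<not> matrix False (recf_code e) (xs @ [v]))"
      unfolding evaluates_iff_derivation snoc if_False not_not
      by (rule dec[of "\<lambda>y. derivation (recf_code e) (xs @ [y]) 0", symmetric])
    finally show ?case by auto }
next
  case (Suc m)
  { case 1
    have "all_prefix (Suc m) R (xs @ [y]) \<longleftrightarrow>
        all_prefix (Suc m) (matrix (odd m) (recf_code e)) (xs @ [y])" for y
      using 1 by (intro Suc.IH(2)) simp
    then show ?case by (simp only: ex_prefix.simps(2)[of "Suc m"] even_Suc) }
  { case 2
    have "ex_prefix (Suc m) R (xs @ [y]) \<longleftrightarrow>
        ex_prefix (Suc m) (matrix (even m) (recf_code e)) (xs @ [y])" for y
      using 2 by (intro Suc.IH(1)) simp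
    then show ?case by (simp only: all_prefix.simps(2)[of "Suc m"] even_Suc not_not) }
qed

text \<open>What is left of a Sigma^0_(m+2) formula after its two leading quantifiers. The flag
  \<open>odd m\<close> is the parity \<open>even (Suc m)\<close> that \<open>matrix_prefixes\<close>
  demands for \<open>m + 2\<close> quantifiers.\<close>

definition sigma_matrix :: "nat \<Rightarrow> nat \<Rightarrow> nat \<Rightarrow> nat \<Rightarrow> nat \<Rightarrow> bool" where
  "sigma_matrix m e x y z \<longleftrightarrow> ex_prefix m (matrix (odd m) e) [x, y, z]"

lemma ldec_sigma_matrix:
  assumes "lcomp m e" "lcomp m x" "lcomp m y" "lcomp m z"
  shows "ldec m (\<lambda>p. sigma_matrix m (e p) (x p) (y p) (z p))"
  unfolding sigma_matrix_def
  using ldec_comp[OF ldec_prefixes(1)[OF ldec_matrix], of m "\<lambda>p. (e p, [x p, y p, z p])" "odd m"]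
  by (simp add: lcomp_intros assms)

lemma sigma0_matrix:
  assumes "sigma0 (Suc (Suc m)) A"
  shows "\<exists>e. A = {x. \<exists>y. \<forall>z. sigma_matrix m e x y z}"
proof -
  obtain R where R: "computable_rel (Suc (Suc (Suc m))) R" "A = {x. ex_prefix (Suc (Suc m)) R [x]}"
    using assms unfolding sigma0_def by blast
  obtain e where e: "\<And>xs. length xs = Suc (Suc (Suc m)) \<Longrightarrow> evaluates e xs (if R xs then 1 else 0)"
    using R(1) unfolding computable_rel_def computable_def by blast
  have "ex_prefix (Suc (Suc m)) R [x] \<longleftrightarrow>
      ex_prefix (Suc (Suc m)) (matrix (even (Suc m)) (recf_code e)) [x]" for x
    using matrix_prefixes(1)[OF e, where xs = "[x]" and m = "Suc m"] by simp
  then show ?thesis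
    unfolding R(2) by (intro exI[of _ "recf_code e"]) (simp add: sigma_matrix_def)
qed

section \<open>Diagonalization against infinite arithmetical sets\<close>

text \<open>
  The requirement \<open>j = (e, c)\<close> asks for a pair of colour \<open>c\<close> in the set with index \<open>e\<close>. A code
  \<open>p = (x, y)\<close> stands for the guess that \<open>y\<close> witnesses membership of \<open>x\<close>. At stage \<open>s\<close> the requirement
  picks \<open>x\<close> from the least guess below \<open>s\<close> that is not refuted below \<open>s\<close>, avoiding the picks \<open>L\<close> of
  earlier requirements; the junk value \<open>s\<close> is returned when no such guess exists.
\<close>

definition guess_unless :: "nat \<Rightarrow> nat \<Rightarrow> nat \<Rightarrow> nat list \<Rightarrow> nat" where
  "guess_unless m s j L =
     (LEAST p. p = s \<or> (\<forall>z<s. sigma_matrix m (pfst j) (pfst p) (psnd p) z) \<and> pfst p \<notin> set L)"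

definition pick :: "nat \<Rightarrow> nat \<Rightarrow> nat \<Rightarrow> nat list \<Rightarrow> nat" where
  "pick m s j L = (if guess_unless m s j L < s then pfst (guess_unless m s j L) else s)"

definition picks :: "nat \<Rightarrow> nat \<Rightarrow> nat \<Rightarrow> nat list" where
  "picks m s j = rec_nat [] (\<lambda>j L. pick m s j L # L) j"

text \<open>The first requirement that picks \<open>x\<close> at stage \<open>s\<close> decides, its
  second component being the desired colour. If none below \<open>s\<close> picks \<open>x\<close>,
  the default \<open>j = s\<close> yields an arbitrary colour.\<close>

definition pair_color :: "nat \<Rightarrow> nat \<Rightarrow> nat \<Rightarrow> nat" where
  "pair_color m x s = psnd (LEAST j. j = s \<or> pick m s j (picks m s j) = x)"

lemma lcomp_pick:
  assumes "lcomp m s" "lcomp m j" "lcomp m L"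
  shows "lcomp m (\<lambda>p. pick m (s p) (j p) (L p))"
proof -
  have "lcomp m (\<lambda>q::nat \<times> nat \<times> nat list. guess_unless m (fst q) (fst (snd q)) (snd (snd q)))"
    unfolding guess_unless_def by (intro lcomp_intros ldec_sigma_matrix)
  then have "lcomp m (\<lambda>q::nat \<times> nat \<times> nat list. pick m (fst q) (fst (snd q)) (snd (snd q)))"
    unfolding pick_def by (intro lcomp_intros)
  from lcomp_comp[OF this, of "\<lambda>p. (s p, j p, L p)"] assms show ?thesis
    by (simp add: lcomp_Pair)
qed

lemma lcomp_pair_color: "lcomp m (\<lambda>p. pair_color m (fst p) (snd p))"
  unfolding pair_color_def picks_def by (intro lcomp_intros lcomp_pick)

lemma picks_simps [simp]: "picks m s 0 = []" "picks m s (Suc j) = pick m s j (picks m s j) # picks m s j"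
  by (simp_all add: picks_def)

lemma length_picks [simp]: "length (picks m s j) = j"
  by (induction j) auto

lemma pick_in_picks: "i < j \<Longrightarrow> pick m s i (picks m s i) \<in> set (picks m s j)"
  by (induction j) (auto simp: less_Suc_eq)

text \<open>Earlier requirements occupy at most \<open>j\<close> numbers, so one of
  \<open>Suc j\<close> elements of \<open>A\<close> stays free, and a true guess for it lies below a
  bound that does not depend on \<open>s\<close>. At late stages all false guesses below this bound
  are refuted, so the least surviving guess is true.\<close>

lemma pair_color_diagonal:
  assumes A: "A = {x. \<exists>y. \<forall>z. sigma_matrix m e x y z}" and inf: "infinite A"
  obtains x s where "x \<in> A" "s \<in> A" "x < s" "pair_color m x s = c"
proof -
  define j where "j = prod_encode (e, c)"
  define P where "P = (\<lambda>p z. sigma_matrix m e (pfst p) (psnd p) z)"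
  obtain Y where Y: "\<And>x z. x \<in> A \<Longrightarrow> P (prod_encode (x, Y x)) z"
  proof -
    have "\<forall>x\<in>A. \<exists>y. \<forall>z. sigma_matrix m e x y z" using A by blast
    then obtain Y where "\<forall>x\<in>A. \<forall>z. sigma_matrix m e x (Y x) z" by metis
    then show thesis by (intro that[of Y]) (auto simp: P_def)
  qed
  \<comment> \<open>\<open>Z p\<close> refutes the guess \<open>p\<close> whenever \<open>p\<close>
    is false.\<close>
  have "\<forall>p. \<exists>z. P p z \<longrightarrow> (\<forall>z. P p z)" by blast
  from choice[OF this] obtain Z where Z: "\<And>p. P p (Z p) \<Longrightarrow> \<forall>z. P p z"
    by blast
  obtain B where B: "finite B" "card B = Suc j" "B \<subseteq> A"
    using infinite_arbitrarily_large[OF inf] by blast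
  obtain b where b: "\<And>x. x \<in> B \<Longrightarrow> prod_encode (x, Y x) < b"
    using B(1) finite_nat_set_iff_bounded[of "(\<lambda>x. prod_encode (x, Y x)) ` B"] by auto
  obtain b' where b': "\<And>p. p < b \<Longrightarrow> Z p < b'"
    using finite_nat_set_iff_bounded[of "Z ` {..<b}"] by auto
  \<comment> \<open>Beyond \<open>b\<close>, the true guesses for \<open>B\<close> are in range;
    beyond \<open>b'\<close>, all false guesses below \<open>b\<close> are refuted; beyond
    \<open>j\<close>, the search in \<open>pair_color\<close> meets \<open>j\<close> before its
    default.\<close>
  obtain s where s: "s \<in> A" "s > b + b' + j"
    using inf unfolding infinite_nat_iff_unbounded by blast
  define L where "L = picks m s j"
  have "card (set L) < card B"
    using card_length[of L] B(2) by (simp add: L_def)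
  then obtain x where x: "x \<in> B" "x \<notin> set L"
    using card_mono[of "set L" B] by (meson List.finite_set leD subsetI)
  define Q where "Q = (\<lambda>p. (\<forall>z<s. P p z) \<and> pfst p \<notin> set L)"
  define p where "p = (LEAST p. p = s \<or> Q p)"
  have guess: "guess_unless m s j L = p"
    by (simp add: guess_unless_def p_def Q_def P_def j_def)
  have "Q (prod_encode (x, Y x))"
    using Y x B(3) by (auto simp: Q_def)
  then have "p < b"
    using b[OF x(1)] Least_le[of "\<lambda>p. p = s \<or> Q p" "prod_encode (x, Y x)"]
    by (simp add: p_def)
  then have "p < s" using s(2) by simp
  moreover have "p = s \<or> Q p"
    unfolding p_def by (rule LeastI[of _ s]) simp
  ultimately have "Q p" by simp
  have "Z p < s" using b'[OF \<open>p < b\<close>] s(2) by simp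
  then have "\<forall>z. P p z" using \<open>Q p\<close> Z unfolding Q_def by blast
  then have "pfst p \<in> A" unfolding A P_def by blast
  have pick: "pick m s j L = pfst p"
    using \<open>p < s\<close> by (simp add: pick_def guess)
  \<comment> \<open>No earlier requirement picked the same number, since all earlier picks are in
    \<open>L\<close>, which the guess \<open>p\<close> avoids.\<close>
  have "(LEAST i. i = s \<or> pick m s i (picks m s i) = pfst p) = j"
  proof (rule Least_equality)
    show "j = s \<or> pick m s j (picks m s j) = pfst p" using pick by (simp add: L_def)
    fix i
    assume i: "i = s \<or> pick m s i (picks m s i) = pfst p"
    show "j \<le> i"
    proof (rule ccontr)
      assume "\<not> j \<le> i"
      then have "pick m s i (picks m s i) \<in> set L" by (simp add: L_def pick_in_picks)
      moreover have "i \<noteq> s" using \<open>\<not> j \<le> i\<close> s(2) by simp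
      ultimately show False using i \<open>Q p\<close> by (simp add: Q_def)
    qed
  qed
  then have "pair_color m (pfst p) s = c"
    by (simp add: pair_color_def j_def)
  moreover have "pfst p < s" using \<open>p < s\<close> pfst_le[of p] by simp
  ultimately show thesis using that \<open>pfst p \<in> A\<close> s(1) by blast
qed

section \<open>From iterated limits to colourings of longer tuples\<close>

text \<open>Nested to the left: an appended entry becomes the second component of a pair, which is
  the position of the stage in \<open>limit_computable\<close>.\<close>

definition tuple_code :: "nat list \<Rightarrow> nat" where
  "tuple_code xs = foldl (\<lambda>a b. prod_encode (a, b)) (hd xs) (tl xs)"

lemma tuple_code_snoc: "xs \<noteq> [] \<Longrightarrow> tuple_code (xs @ [x]) = prod_encode (tuple_code xs, x)"
  by (cases xs) (simp_all add: tuple_code_def)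

lemma computable_tuple_code: "computable (Suc n) tuple_code"
proof -
  have "computable (Suc n) (\<lambda>xs. tuple_code (take (Suc i) xs))" if "i \<le> n" for i
    using that
  proof (induction i)
    case 0
    show ?case
      by (rule computable_cong[of _ "\<lambda>xs. xs ! 0"])
        (auto simp: length_Suc_conv tuple_code_def)
  next
    case (Suc i)
    show ?case
    proof (rule computable_cong)
      show "computable (Suc n) (\<lambda>xs. prod_encode (tuple_code (take (Suc i) xs), xs ! Suc i))"
        using Suc by (intro computable_prod_encode) auto
      show "prod_encode (tuple_code (take (Suc i) xs), xs ! Suc i) = tuple_code (take (Suc (Suc i)) xs)"
        if "length xs = Suc n" for xs
      proof -
        have "take (Suc i) xs \<noteq> []" using that by auto
        moreover have "take (Suc (Suc i)) xs = take (Suc i) xs @ [xs ! Suc i]"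
          using that Suc.prems by (intro take_Suc_conv_app_nth) simp
        ultimately show ?thesis by (metis tuple_code_snoc)
      qed
    qed
  qed
  from this[of n] show ?thesis
    by (rule computable_cong) auto
qed

definition attains :: "nat set \<Rightarrow> nat \<Rightarrow> (nat \<Rightarrow> nat) \<Rightarrow> nat \<Rightarrow> bool" where
  "attains A l F c \<longleftrightarrow>
     (\<exists>xs. sorted_wrt (<) xs \<and> set xs \<subseteq> A \<and> length xs = l \<and> F (tuple_code xs) = c)"

text \<open>As \<open>A\<close> is infinite, it has an element that is past the given tuple and late
  enough as a stage for the limit to be reached. Appending it extends the tuple.\<close>

lemma attains_limit:
  assumes lim: "\<And>x. eventually (\<lambda>s. G (prod_encode (x, s)) = F x) sequentially"
    and A: "infinite A" and F: "attains A l F c" and "l > 0"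
  shows "attains A (Suc l) G c"
proof -
  obtain xs where xs: "sorted_wrt (<) xs" "set xs \<subseteq> A" "length xs = l" "F (tuple_code xs) = c"
    using F unfolding attains_def by blast
  obtain N where N: "\<And>s. s \<ge> N \<Longrightarrow> G (prod_encode (tuple_code xs, s)) = c"
    using lim[of "tuple_code xs"] xs(4) unfolding eventually_sequentially by blast
  obtain b where b: "\<And>x. x \<in> set xs \<Longrightarrow> x < b"
    using finite_nat_set_iff_bounded[of "set xs"] by auto
  obtain s where s: "s \<in> A" "s > N + b"
    using A unfolding infinite_nat_iff_unbounded by blast
  have "xs \<noteq> []" using xs(3) \<open>l > 0\<close> by auto
  then have "G (tuple_code (xs @ [s])) = c" using N[of s] s(2) by (simp add: tuple_code_snoc)
  moreover have "sorted_wrt (<) (xs @ [s])"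
    using xs(1) b s(2) by (fastforce simp: sorted_wrt_append)
  ultimately show ?thesis
    unfolding attains_def using xs s(1) by (intro exI[of _ "xs @ [s]"]) auto
qed

text \<open>Each limit is traded for one more entry of the tuple. \<open>G\<close> is chosen before
  \<open>A\<close> and \<open>c\<close>, so one function serves all infinite sets.\<close>

lemma attains_limit_computable:
  "limit_computable m F \<Longrightarrow> l > 0 \<Longrightarrow> \<exists>G. computable_fun G \<and>
     (\<forall>A c. infinite A \<longrightarrow> attains A l F c \<longrightarrow> attains A (l + m) G c)"
proof (induction m arbitrary: F l)
  case 0
  then show ?case by auto
next
  case (Suc m)
  obtain F' where F': "limit_computable m F'"
    "\<And>x. eventually (\<lambda>s. F' (prod_encode (x, s)) = F x) sequentially"
    using limit_computable_SucE[OF Suc.prems(1)] by blast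
  obtain G where G: "computable_fun G"
    "\<And>A c. infinite A \<Longrightarrow> attains A (Suc l) F' c \<Longrightarrow> attains A (Suc l + m) G c"
    using Suc.IH[OF F'(1), of "Suc l"] by blast
  show ?case
    using G attains_limit[OF F'(2) _ _ Suc.prems(2)] by (intro exI[of _ G]) auto
qed

lemma computable_fun_lcomp: "lcomp 0 f \<Longrightarrow> computable_fun f"
  by (simp add: lcomp_def)

text \<open>With \<open>n = m + 2\<close>, a Sigma^0_n set has a matrix decidable with
  \<open>m\<close> limits; trading these limits for entries turns the colouring of pairs into one of
  \<open>n\<close>-tuples.\<close>

lemma sigma0_attains_all_colors:
  assumes "n \<ge> 2" "k > 0"
  obtains f where "f \<in> [UNIV]\<^bsup>n\<^esup> \<rightarrow> {1..k}" "computable_coloring n f"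
    "\<And>A. sigma0 n A \<Longrightarrow> infinite A \<Longrightarrow> {1..k} \<subseteq> f ` [A]\<^bsup>n\<^esup>"
proof -
  obtain m where m: "n = Suc (Suc m)"
    using assms(1) by (metis add_2_eq_Suc le_Suc_ex)
  define F where "F n = pair_color m (pfst n) (psnd n)" for n
  have "limit_computable m F"
    using lcomp_pair_color[of m] by (simp add: F_def[abs_def] lcomp_def dec_prod_def)
  then obtain G where G: "computable_fun G"
    "\<And>A c. infinite A \<Longrightarrow> attains A 2 F c \<Longrightarrow> attains A (2 + m) G c"
    using attains_limit_computable[of m F 2] by auto
  \<comment> \<open>Values below \<open>k\<close> are shifted into \<open>{1..k}\<close>; all others
    are sent to 1.\<close>
  define f where "f S = (let c = G (tuple_code (sorted_list_of_set S)) in if c < k then Suc c else 1)" for S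
  have "f \<in> [UNIV]\<^bsup>n\<^esup> \<rightarrow> {1..k}"
    using assms(2) by (auto simp: f_def Let_def)
  moreover have "computable_coloring n f"
  proof -
    have "lcomp 0 (\<lambda>c. if c < k then Suc c else 1)" by (intro lcomp_intros)
    then have "computable_fun (\<lambda>c. if c < k then Suc c else 1)" by (rule computable_fun_lcomp)
    then have "computable n (\<lambda>xs. if G (tuple_code xs) < k then Suc (G (tuple_code xs)) else 1)"
      unfolding m by (rule computable_app[OF _ computable_app[OF G(1) computable_tuple_code]])
    then show ?thesis
      unfolding computable_coloring_def f_def Let_def by (intro exI conjI) auto
  qed
  moreover have "{1..k} \<subseteq> f ` [A]\<^bsup>n\<^esup>" if A: "sigma0 n A" "infinite A" for A
  proof
    fix c
    assume c: "c \<in> {1..k}"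
    obtain e where e: "A = {x. \<exists>y. \<forall>z. sigma_matrix m e x y z}"
      using sigma0_matrix[OF A(1)[unfolded m]] ..
    obtain x s where xs: "x \<in> A" "s \<in> A" "x < s" "pair_color m x s = c - 1"
      using pair_color_diagonal[OF e A(2)] .
    then have "attains A 2 F (c - 1)"
      unfolding attains_def F_def by (intro exI[of _ "[x, s]"]) (simp add: tuple_code_def)
    then have "attains A n G (c - 1)"
      using G(2)[OF A(2)] by (simp add: m)
    then obtain ys where ys: "sorted_wrt (<) ys" "set ys \<subseteq> A" "length ys = n" "G (tuple_code ys) = c - 1"
      unfolding attains_def by blast
    have "sorted_list_of_set (set ys) = ys"
      using ys(1) by (simp add: sorted_list_of_set.idem_if_sorted_distinct strict_sorted_iff)
    then have "f (set ys) = c" using ys(4) c by (auto simp: f_def Let_def)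
    moreover have "set ys \<in> [A]\<^bsup>n\<^esup>"
      using ys by (simp add: nsets_def distinct_card strict_sorted_iff)
    ultimately show "c \<in> f ` [A]\<^bsup>n\<^esup>" by blast
  qed
  ultimately show thesis by (rule that)
qed

section \<open>A computable bound for Ramsey's theorem\<close>

lemma pigeonhole_fibre:
  assumes "finite Z" "finite Y" "Y \<noteq> {}" "f ` Z \<subseteq> Y" "N * card Y \<le> card Z"
  obtains y where "y \<in> Y" "N \<le> card {z \<in> Z. f z = y}"
proof -
  have "\<exists>y\<in>Y. N \<le> card {z \<in> Z. f z = y}"
  proof (rule ccontr)
    assume "\<not> ?thesis"
    then have "(\<Sum>y\<in>Y. card {z \<in> Z. f z = y}) < of_nat (card Y) * N"
      using assms(2,3) by (intro sum_bounded_above_strict) (auto simp: card_gt_0_iff)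
    moreover have "card Z \<le> (\<Sum>y\<in>Y. card {z \<in> Z. f z = y})"
    proof -
      have "Z = (\<Union>y\<in>Y. {z \<in> Z. f z = y})" using assms(4) by auto
      then show ?thesis using card_UN_le[OF assms(2)] by metis
    qed
    ultimately show False using assms(5) by (simp add: mult.commute)
  qed
  then show thesis using that by blast
qed

text \<open>
  The set \<open>C\<close> is being built, \<open>Z\<close> is the reservoir of candidates for its later elements, and \<open>h S\<close>
  is the colour that \<open>S\<close> gets together with any later element.
\<close>

definition end_homogeneous ::
    "nat \<Rightarrow> (nat set \<Rightarrow> nat) \<Rightarrow> nat set \<Rightarrow> nat set \<Rightarrow> (nat set \<Rightarrow> nat) \<Rightarrow> bool" where
  "end_homogeneous n g C Z h \<longleftrightarrow>
     (\<forall>S\<in>[C]\<^bsup>n\<^esup>. \<forall>z\<in>Z. g (insert z S) = h S) \<and> (\<forall>T\<in>[C]\<^bsup>Suc n\<^esup>. \<exists>S\<in>[T]\<^bsup>n\<^esup>. g T = h S)"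

text \<open>A point \<open>z\<close> moves from the reservoir into \<open>C\<close>. The new
  \<open>n\<close>-sets are those containing \<open>z\<close>, at most \<open>2 ^ t\<close> many;
  the remaining candidates are sorted by the colours they give to these sets, and one of the at most
  \<open>c ^ 2 ^ t\<close> classes has \<open>N\<close> elements.\<close>

lemma end_homogeneous_extend:
  fixes c :: nat
  assumes fin: "finite C" "finite Z" "C \<inter> Z = {}"
    and eh: "end_homogeneous n g C Z h"
    and g: "g \<in> [C \<union> Z]\<^bsup>Suc n\<^esup> \<rightarrow> {1..c}" and "c > 0" "card C \<le> t"
    and Z: "Suc (N * c ^ 2 ^ t) \<le> card Z"
  obtains z Z' h' where "z \<in> Z" "Z' \<subseteq> Z - {z}" "N \<le> card Z'" "end_homogeneous n g (insert z C) Z' h'"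
proof -
  obtain z where z: "z \<in> Z" using Z by fastforce
  then have zC: "z \<notin> C" using fin by blast
  define D where "D = {S \<in> [insert z C]\<^bsup>n\<^esup>. z \<in> S}"
  have "D \<subseteq> (insert z) ` Pow C"
  proof
    fix S
    assume "S \<in> D"
    then have "S = insert z (S - {z})" "S - {z} \<subseteq> C" by (auto simp: D_def nsets_def)
    then show "S \<in> (insert z) ` Pow C" by blast
  qed
  moreover have "card ((insert z) ` Pow C) \<le> 2 ^ card C"
    using card_image_le[of "Pow C" "insert z"] fin by (simp add: card_Pow)
  ultimately have D: "finite D" "card D \<le> 2 ^ card C"
    using fin(1) by (auto intro: finite_subset order_trans[OF card_mono[rotated]])
  then have "card D \<le> 2 ^ t"
    using \<open>card C \<le> t\<close> by (meson le_trans one_le_numeral power_increasing)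
  define \<psi> where "\<psi> w = (\<lambda>S\<in>D. g (insert w S))" for w
  have "card (D \<rightarrow>\<^sub>E {1..c}) = c ^ card D" using D(1) by (simp add: card_funcsetE)
  also have "\<dots> \<le> c ^ 2 ^ t" using \<open>card D \<le> 2 ^ t\<close> \<open>c > 0\<close> by (simp add: power_increasing)
  finally have "N * card (D \<rightarrow>\<^sub>E {1..c}) \<le> N * c ^ 2 ^ t" by simp
  also have "\<dots> \<le> card (Z - {z})" using Z z fin by simp
  finally have big: "N * card (D \<rightarrow>\<^sub>E {1..c}) \<le> card (Z - {z})" .
  have "\<psi> ` (Z - {z}) \<subseteq> D \<rightarrow>\<^sub>E {1..c}"
  proof -
    have "g (insert w S) \<in> {1..c}" if "w \<in> Z - {z}" "S \<in> D" for w S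
    proof -
      have "S \<subseteq> insert z C" "finite S" "card S = n" using that by (auto simp: D_def nsets_def)
      moreover have "w \<notin> insert z C" using that fin(3) by blast
      ultimately have "insert w S \<in> [C \<union> Z]\<^bsup>Suc n\<^esup>"
        using that z by (auto simp: nsets_def card_insert_if)
      then show ?thesis using g by blast
    qed
    then show ?thesis unfolding \<psi>_def by auto
  qed
  moreover have "(D \<rightarrow>\<^sub>E {1..c}) \<noteq> {}" using \<open>c > 0\<close> by (auto simp: PiE_eq_empty_iff)
  moreover have "finite (D \<rightarrow>\<^sub>E {1..c})" using D(1) by (intro finite_PiE) auto
  moreover have "finite (Z - {z})" using fin(2) by simp
  ultimately obtain y where y: "N \<le> card {w \<in> Z - {z}. \<psi> w = y}"
    using pigeonhole_fibre[of "Z - {z}" "D \<rightarrow>\<^sub>E {1..c}" \<psi> N] big by metis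
  define Z' where "Z' = {w \<in> Z - {z}. \<psi> w = y}"
  define h' where "h' S = (if z \<in> S then y S else h S)" for S
  have "end_homogeneous n g (insert z C) Z' h'"
    unfolding end_homogeneous_def
  proof (intro conjI ballI)
    fix S w
    assume S: "S \<in> [insert z C]\<^bsup>n\<^esup>" and w: "w \<in> Z'"
    show "g (insert w S) = h' S"
    proof (cases "z \<in> S")
      case True
      then have "S \<in> D" using S by (simp add: D_def)
      then have "g (insert w S) = \<psi> w S" by (simp add: \<psi>_def)
      then show ?thesis using w True by (simp add: Z'_def h'_def)
    next
      case False
      then have "S \<in> [C]\<^bsup>n\<^esup>" using S by (auto simp: nsets_def)
      then show ?thesis using eh w False by (auto simp: end_homogeneous_def Z'_def h'_def)
    qed
  next
    fix T
    assume T: "T \<in> [insert z C]\<^bsup>Suc n\<^esup>"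
    show "\<exists>S\<in>[T]\<^bsup>n\<^esup>. g T = h' S"
    proof (cases "z \<in> T")
      case True
      then have S: "T - {z} \<in> [C]\<^bsup>n\<^esup>" "T - {z} \<in> [T]\<^bsup>n\<^esup>" "insert z (T - {z}) = T"
        using T by (auto simp: nsets_def)
      \<comment> \<open>Since \<open>z\<close> comes from the old reservoir, \<open>h\<close>
        already predicts this colour.\<close>
      then have "g T = h (T - {z})" using eh z unfolding end_homogeneous_def by metis
      then show ?thesis using S(2) by (intro bexI[of _ "T - {z}"]) (simp_all add: h'_def)
    next
      case False
      then have "T \<in> [C]\<^bsup>Suc n\<^esup>" using T by (auto simp: nsets_def)
      then obtain S where "S \<in> [T]\<^bsup>n\<^esup>" "g T = h S"
        using eh unfolding end_homogeneous_def by blast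
      moreover from this have "z \<notin> S" using False by (auto simp: nsets_def)
      ultimately show ?thesis by (intro bexI[of _ S]) (simp_all add: h'_def)
    qed
  qed
  then show thesis using that[of z Z' h'] z y by (auto simp: Z'_def)
qed

text \<open>The size that allows \<open>r\<close> extensions: each uses up one point and keeps at
  least a \<open>K\<close>-th part of the rest. The initial value 1 leaves a nonempty reservoir at
  the end.\<close>

definition reservoir :: "nat \<Rightarrow> nat \<Rightarrow> nat" where
  "reservoir K r = rec_nat 1 (\<lambda>_ q. Suc (q * K)) r"

text \<open>Iterates \<open>end_homogeneous_extend\<close>. The fixed \<open>t\<close> bounds every
  size that \<open>C\<close> takes on, so the same loss factor applies at each step.\<close>

lemma end_homogeneous_exists:
  assumes "finite C" "finite Z" "C \<inter> Z = {}" "end_homogeneous n g C Z h"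
    "g \<in> [C \<union> Z]\<^bsup>Suc n\<^esup> \<rightarrow> {1..c}" "c > 0" "card C + r \<le> t" "reservoir (c ^ 2 ^ t) r \<le> card Z"
  shows "\<exists>C' Z' h'. C' \<subseteq> C \<union> Z \<and> Z' \<subseteq> Z \<and> C' \<inter> Z' = {} \<and> finite C' \<and> card C' = card C + r \<and>
    Z' \<noteq> {} \<and> end_homogeneous n g C' Z' h'"
  using assms
proof (induction r arbitrary: C Z h)
  case 0
  then have "Z \<noteq> {}" by (auto simp: reservoir_def)
  with 0 show ?case by (intro exI[of _ C] exI[of _ Z] exI[of _ h]) auto
next
  case (Suc r)
  have "Suc (reservoir (c ^ 2 ^ t) r * c ^ 2 ^ t) \<le> card Z"
    using Suc.prems(8) by (simp add: reservoir_def)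
  then obtain z Z' h' where z: "z \<in> Z" and Z': "Z' \<subseteq> Z - {z}" "reservoir (c ^ 2 ^ t) r \<le> card Z'"
    and h': "end_homogeneous n g (insert z C) Z' h'"
    by (rule end_homogeneous_extend[OF Suc.prems(1-6), of t, rotated]) (use Suc.prems(7) in auto)
  have card: "card (insert z C) = Suc (card C)" using z Suc.prems(1,3) by (auto simp: card_insert_if)
  have "\<exists>C'' Z'' h''. C'' \<subseteq> insert z C \<union> Z' \<and> Z'' \<subseteq> Z' \<and> C'' \<inter> Z'' = {} \<and> finite C'' \<and>
      card C'' = card (insert z C) + r \<and> Z'' \<noteq> {} \<and> end_homogeneous n g C'' Z'' h''"
  proof (rule Suc.IH[OF _ _ _ h' _ Suc.prems(6) _ Z'(2)])
    show "finite Z'" using Z'(1) Suc.prems(2) by (meson finite_Diff finite_subset)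
    have "insert z C \<union> Z' \<subseteq> C \<union> Z" using z Z'(1) by blast
    from nsets_Pi_contra[OF this] show "g \<in> [insert z C \<union> Z']\<^bsup>Suc n\<^esup> \<rightarrow> {1..c}"
      using Suc.prems(5) by blast
  qed (use Suc.prems Z'(1) card in auto)
  then obtain C'' Z'' h'' where *: "C'' \<subseteq> insert z C \<union> Z'" "Z'' \<subseteq> Z'" "C'' \<inter> Z'' = {}" "finite C''"
      "card C'' = card (insert z C) + r" "Z'' \<noteq> {}" "end_homogeneous n g C'' Z'' h''"
    by blast
  show ?case
    using * z Z'(1) card by (intro exI[of _ C''] exI[of _ Z''] exI[of _ h'']) auto
qed

lemma lcomp_computable_fun: "computable_fun F \<Longrightarrow> lcomp m f \<Longrightarrow> lcomp m (\<lambda>x. F (f x))"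
  by (rule lcomp_app) simp_all

section \<open>Ramsey's theorem by induction on the exponent\<close>

definition ramsey_bound :: "nat \<Rightarrow> nat \<Rightarrow> (nat \<Rightarrow> nat) \<Rightarrow> bool" where
  "ramsey_bound n c B \<longleftrightarrow> (\<forall>m X. \<forall>g \<in> [X :: nat set]\<^bsup>n\<^esup> \<rightarrow> {1..c}. finite X \<longrightarrow> B m \<le> card X \<longrightarrow>
     (\<exists>H\<in>[X]\<^bsup>m\<^esup>. \<exists>d. \<forall>S\<in>[H]\<^bsup>n\<^esup>. g S = d))"

lemma ramsey_boundD:
  assumes "ramsey_bound n c B" "g \<in> [X :: nat set]\<^bsup>n\<^esup> \<rightarrow> {1..c}" "finite X" "B m \<le> card X"
  shows "\<exists>H\<in>[X]\<^bsup>m\<^esup>. \<exists>d. \<forall>S\<in>[H]\<^bsup>n\<^esup>. g S = d"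
  using assms unfolding ramsey_bound_def by blast

text \<open>The induction step builds an end-homogeneous set of \<open>B m\<close> points and
  applies the bound for exponent \<open>n\<close> to the colouring \<open>h\<close> of its
  \<open>n\<close>-sets. The bound is an explicit recursion, hence computable.\<close>

lemma computable_ramsey_bound:
  assumes "n > 0" "c > 0"
  shows "\<exists>B. computable_fun B \<and> ramsey_bound n c B"
  using assms(1)
proof (induction n rule: nat_induct_non_zero)
  case 1
  have "\<exists>H\<in>[X]\<^bsup>m\<^esup>. \<exists>d. \<forall>S\<in>[H]\<^bsup>1\<^esup>. g S = d"
    if g: "g \<in> [X]\<^bsup>1\<^esup> \<rightarrow> {1..c}" and X: "finite X" "m * c \<le> card X" for m X and g :: "nat set \<Rightarrow> nat"
  proof -
    have img: "(\<lambda>x. g {x}) ` X \<subseteq> {1..c}"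
    proof
      fix d
      assume "d \<in> (\<lambda>x. g {x}) ` X"
      then obtain x where "x \<in> X" "d = g {x}" by blast
      moreover from this have "{x} \<in> [X]\<^bsup>1\<^esup>" by (simp add: nsets_def)
      ultimately show "d \<in> {1..c}" using g by blast
    qed
    have "{1..c} \<noteq> {}" "m * card {1..c} \<le> card X" using assms(2) X(2) by auto
    then obtain d where "m \<le> card {x \<in> X. g {x} = d}"
      using pigeonhole_fibre[OF X(1) finite_atLeastAtMost _ img] by blast
    then obtain H where H: "H \<subseteq> {x \<in> X. g {x} = d}" "card H = m" "finite H"
      by (rule obtain_subset_with_card_n)
    have "g S = d" if "S \<in> [H]\<^bsup>1\<^esup>" for S
    proof -
      have "S \<subseteq> H" "card S = 1" using that by (simp_all add: nsets_def)
      moreover from this(2) obtain x where "S = {x}" by (rule card_1_singletonE)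
      ultimately show ?thesis using H(1) by auto
    qed
    moreover have "H \<in> [X]\<^bsup>m\<^esup>" using H by (auto simp: nsets_def)
    ultimately show ?thesis by blast
  qed
  moreover have "computable_fun (\<lambda>m. m * c)"
    by (intro computable_fun_lcomp lcomp_intros)
  ultimately show ?case unfolding ramsey_bound_def by blast
next
  case (Suc n)
  then obtain B where B: "computable_fun B" "ramsey_bound n c B" by blast
  let ?B = "\<lambda>m. reservoir (c ^ 2 ^ B m) (B m)"
  have "\<exists>H\<in>[X]\<^bsup>m\<^esup>. \<exists>d. \<forall>S\<in>[H]\<^bsup>Suc n\<^esup>. g S = d"
    if g: "g \<in> [X]\<^bsup>Suc n\<^esup> \<rightarrow> {1..c}" and X: "finite X" "?B m \<le> card X"
    for m X and g :: "nat set \<Rightarrow> nat"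
  proof -
    \<comment> \<open>Vacuous: for \<open>n > 0\<close> the empty set has no
      \<open>n\<close>-subsets.\<close>
    have "end_homogeneous n g {} X h" for h
      using Suc.hyps by (auto simp: end_homogeneous_def nsets_empty_iff)
    then obtain C Z h where C: "C \<subseteq> X" "Z \<subseteq> X" "C \<inter> Z = {}" "finite C" "card C = B m" "Z \<noteq> {}"
        "end_homogeneous n g C Z h"
      using end_homogeneous_exists[of "{}" X n g _ c "B m" "B m"] X g assms(2) by auto
    \<comment> \<open>A point left over in the reservoir shows that \<open>h\<close> takes its
      values in \<open>{1..c}\<close>.\<close>
    obtain z where z: "z \<in> Z" using C by blast
    have "h S \<in> {1..c}" if "S \<in> [C]\<^bsup>n\<^esup>" for S
    proof -
      have "insert z S \<in> [X]\<^bsup>Suc n\<^esup>"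
        using that z C(1-3) by (auto simp: nsets_def card_insert_if)
      moreover have "g (insert z S) = h S" using C(7) that z by (simp add: end_homogeneous_def)
      ultimately show ?thesis using g by force
    qed
    then obtain H d where H: "H \<in> [C]\<^bsup>m\<^esup>" "\<forall>S\<in>[H]\<^bsup>n\<^esup>. h S = d"
      using ramsey_boundD[OF B(2), of h C m] C(4,5) by auto
    have "g T = d" if T: "T \<in> [H]\<^bsup>Suc n\<^esup>" for T
    proof -
      have "T \<in> [C]\<^bsup>Suc n\<^esup>" using T H(1) by (auto simp: nsets_def)
      then obtain S where S: "S \<in> [T]\<^bsup>n\<^esup>" "g T = h S"
        using C(7) unfolding end_homogeneous_def by blast
      have "S \<in> [H]\<^bsup>n\<^esup>" using S(1) T by (auto simp: nsets_def)
      then show ?thesis using S(2) H(2) by simp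
    qed
    moreover have "H \<in> [X]\<^bsup>m\<^esup>" using H(1) C(1) by (auto simp: nsets_def)
    ultimately show ?thesis by blast
  qed
  then have "ramsey_bound (Suc n) c ?B" unfolding ramsey_bound_def by blast
  moreover have "computable_fun ?B"
    unfolding reservoir_def
    by (intro computable_fun_lcomp lcomp_intros lcomp_computable_fun[OF B(1)])
  ultimately show ?case by blast
qed

section \<open>A slow function read off the Ramsey bound\<close>

lemma computable_arrows_function:
  fixes n c :: nat
  assumes "n > 0" "c > 0"
  obtains \<phi> where "computable_fun \<phi>" "\<And>w. arrows w (\<phi> w) n c" "liminf (\<lambda>w. enat (\<phi> w)) = \<infinity>"
proof -
  obtain B where B: "computable_fun B" "ramsey_bound n c B"
    using computable_ramsey_bound[OF assms] by blast
  \<comment> \<open>The first value whose successor is not guaranteed by \<open>B\<close> at size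
    \<open>w\<close>, with cap \<open>w\<close> to bound the search. Minimality gives
    \<open>B (\<phi> w) \<le> w\<close> whenever \<open>\<phi> w\<close> is positive, so
    \<open>B\<close> may fail to be monotone.\<close>
  define \<phi> where "\<phi> w = (LEAST m. m = w \<or> w < B (Suc m))" for w
  have "computable_fun \<phi>"
    unfolding \<phi>_def[abs_def]
    by (intro computable_fun_lcomp lcomp_intros lcomp_computable_fun[OF B(1)])
  moreover have "arrows w (\<phi> w) n c" for w
    unfolding arrows_def
  proof (intro ballI)
    fix X g
    assume X: "X \<in> [UNIV :: nat set]\<^bsup>w\<^esup>" and g: "g \<in> [X]\<^bsup>n\<^esup> \<rightarrow> {1..c}"
    show "\<exists>H\<in>[X]\<^bsup>\<phi> w\<^esup>. \<exists>d. \<forall>S\<in>[H]\<^bsup>n\<^esup>. g S = d"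
    proof (cases "\<phi> w")
      case 0
      \<comment> \<open>The empty set is homogeneous because \<open>n > 0\<close>.\<close>
      then show ?thesis using assms(1) by (auto simp: nsets_empty_iff)
    next
      case (Suc m)
      then have "m < \<phi> w" by simp
      from not_less_Least[OF this[unfolded \<phi>_def]] have "B (\<phi> w) \<le> w" using Suc by simp
      then show ?thesis using X ramsey_boundD[OF B(2) g, of "\<phi> w"] by (simp add: nsets_def)
    qed
  qed
  moreover have "liminf (\<lambda>w. enat (\<phi> w)) = \<infinity>"
  proof -
    have "enat N \<le> liminf (\<lambda>w. enat (\<phi> w))" for N
    proof (rule Liminf_bounded)
      \<comment> \<open>From \<open>N + b\<close> on, \<open>w\<close> exceeds both \<open>N\<close>
        and the bounds for \<open>1, ..., N\<close> or equals such a value at worst, so neither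
        disjunct defining \<open>\<phi> w\<close> can hold below \<open>N\<close>.\<close>
      obtain b where b: "\<And>i. i < N \<Longrightarrow> B (Suc i) < b"
        using finite_nat_set_iff_bounded[of "(\<lambda>i. B (Suc i)) ` {..<N}"] by auto
      have "enat N \<le> enat (\<phi> w)" if "w \<ge> N + b" for w
      proof -
        have "\<phi> w = w \<or> w < B (Suc (\<phi> w))"
          unfolding \<phi>_def by (rule LeastI[of _ w]) simp
        then have "\<not> \<phi> w < N" using b[of "\<phi> w"] that by auto
        then show ?thesis by simp
      qed
      then show "\<forall>\<^sub>F w in sequentially. enat N \<le> enat (\<phi> w)"
        unfolding eventually_sequentially by blast
    qed
    then show ?thesis
      by (cases "liminf (\<lambda>w. enat (\<phi> w))") (use not_less_eq_eq in auto)
  qed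
  ultimately show thesis by (rule that)
qed

section \<open>Packed sets are infinite, and the conclusion\<close>

lemma packed_infinite:
  assumes lim: "liminf (\<lambda>w. enat (\<phi> w)) = \<infinity>" and A: "packed \<phi> A"
  shows "infinite A"
proof
  assume fin: "finite A"
  \<comment> \<open>A finite set has at most \<open>card A\<close> elements in any interval, while
    \<open>\<phi>\<close> eventually exceeds this number.\<close>
  have "enat (card A) < liminf (\<lambda>w. enat (\<phi> w))" unfolding lim by simp
  then have "\<forall>\<^sub>F w in sequentially. enat (card A) < enat (\<phi> w)" by (rule less_LiminfD)
  then have "\<forall>\<^sub>F w in sequentially. \<not> card (A \<inter> {1..w}) \<ge> \<phi> w"
  proof (rule eventually_mono)
    fix w
    assume "enat (card A) < enat (\<phi> w)"
    moreover have "card (A \<inter> {1..w}) \<le> card A" by (rule card_mono[OF fin]) simp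
    ultimately show "\<not> card (A \<inter> {1..w}) \<ge> \<phi> w" by simp
  qed
  then show False
    using A unfolding packed_def frequently_cofinite[symmetric] cofinite_eq_sequentially
    by (simp add: frequently_def)
qed

theorem theorem6p7:
  fixes n k :: nat
  assumes "n \<ge> 2" and "k > 2 ^ (n - 1)"
  shows "\<exists>(f :: nat set \<Rightarrow> nat) (\<phi> :: nat \<Rightarrow> nat).
           f \<in> [UNIV]\<^bsup>n\<^esup> \<rightarrow> {1..k} \<and> computable_coloring n f \<and>
           computable_fun \<phi> \<and>
           (\<forall>w. arrows w (\<phi> w) n (k + 1)) \<and>
           liminf (\<lambda>w. enat (\<phi> w)) = \<infinity> \<and>
           \<not> (\<exists>A. sigma0 n A \<and> packed \<phi> A \<and> semi_homogeneous n f A)"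
proof -
  obtain f where f: "f \<in> [UNIV]\<^bsup>n\<^esup> \<rightarrow> {1..k}" "computable_coloring n f"
    "\<And>A. sigma0 n A \<Longrightarrow> infinite A \<Longrightarrow> {1..k} \<subseteq> f ` [A]\<^bsup>n\<^esup>"
    using sigma0_attains_all_colors[of n k] assms by auto
  obtain \<phi> where \<phi>: "computable_fun \<phi>" "\<And>w. arrows w (\<phi> w) n (k + 1)"
    "liminf (\<lambda>w. enat (\<phi> w)) = \<infinity>"
    using computable_arrows_function[of n "k + 1"] assms(1) by auto
  have "\<not> (sigma0 n A \<and> packed \<phi> A \<and> semi_homogeneous n f A)" for A
  proof
    assume A: "sigma0 n A \<and> packed \<phi> A \<and> semi_homogeneous n f A"
    then have "{1..k} \<subseteq> f ` [A]\<^bsup>n\<^esup>" using f(3) packed_infinite[OF \<phi>(3)] by blast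
    \<comment> \<open>All \<open>k\<close> colours occur on \<open>A\<close>, more than the
      \<open>2 ^ (n - 1)\<close> that semi-homogeneity permits.\<close>
    then have "card {1..k} \<le> card (f ` [A]\<^bsup>n\<^esup>)"
      using A by (intro card_mono) (simp_all add: semi_homogeneous_def)
    then show False using A assms(2) by (simp add: semi_homogeneous_def)
  qed
  then show ?thesis using f \<phi> by blast
qed

end
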